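(* For every integer $n\ge 5$, one has $\mathcal{T}_1(\Delta_n,n)=\mathcal{T}_2(\Delta_n,n)\cong M_{n-2}(\mathbb{C})\oplus\mathbb{C}\oplus\mathbb{C}$ and $\mathcal{T}_3(\Delta_n,n)=\mathcal{T}_4(\Delta_n,n)\cong M_{n-2}(\mathbb{C})\oplus M_2(\mathbb{C})$ as $\mathbb{C}$-algebras. In particular, $\dim\mathcal{T}_1(\Delta_n,n)=\dim\mathcal{T}_2(\Delta_n,n)=n^2-4n+6<n^2-4n+8=\dim\mathcal{T}_3(\Delta_n,n)=\dim\mathcal{T}_4(\Delta_n,n)$.
   Context: For $n\ge5$, $\Delta_n$ is the graph with vertex set $\{1,\dots,n\}$ and edges $\{1,2\},\{2,3\},\{3,4\}$; $\{i,5\}$ for $i=1,2,3,4$; and $\{j,j+1\}$ for $5\le j\le n-1$. For a finite connected simple graph $\Gamma=(X,E)$ with adjacency matrix $A$ and base vertex $x_0\in X$, $M_X(\mathbb{C})$ is the algebra of complex matrices with rows and columns indexed by $X$. For $Y\subset X$, $E_Y$ is the diagonal matrix with $(x,x)$-entry $1$ if $x\in Y$ and $0$ otherwise; $E_x=E_{\{x\}}$. $\mathbb{C}\langle S\rangle$ is the unital $\mathbb{C}$-subalgebra of $M_X(\mathbb{C})$ generated by $S$. Let $X_k=\{x\in X:\partial(x_0,x)=k\}$ ($\partial$ the graph distance), $D=\max_{x}\partial(x_0,x)$, $G_{x_0}$ the stabilizer of $x_0$ in $\mathrm{Aut}(\Gamma)$, and $Y_1,\dots,Y_r$ the $G_{x_0}$-orbits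 on $X$. Then $\mathcal{T}_1(\Gamma,x_0)=\mathbb{C}\langle A,E_{x_0}\rangle$, $\mathcal{T}_2(\Gamma,x_0)=\mathbb{C}\langle A,E_{X_0},\dots,E_{X_D}\rangle$, $\mathcal{T}_3(\Gamma,x_0)=\mathbb{C}\langle A,E_{Y_1},\dots,E_{Y_r}\rangle$, and $\mathcal{T}_4(\Gamma,x_0)=\{M\in M_X(\mathbb{C}): M_{\sigma(x),\sigma(y)}=M_{x,y}\ \text{for all } x,y\in X,\ \sigma\in G_{x_0}\}$. *)

theory Defs
  imports
    Complex_Main
    "HOL-Library.Function_Algebras"
    "HOL-Combinatorics.Permutations"
    "HOL-Algebra.Module"
    "HOL-Algebra.Subrings"
    "HOL-Algebra.QuotRing"
    "HOL-Algebra.Chinese_Remainder"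
begin

section \<open>Complex matrices indexed by a finite set\<close>

text \<open>
  A matrix with rows and columns indexed by \<open>X\<close> is a function of two arguments that vanishes
  outside \<open>X \<times> X\<close>. Not-necessarily-commutative complex algebras are represented by the
  \<open>module\<close> record of HOL-Algebra, which has ring operations and a scalar multiplication.
  Zero and addition below are the pointwise ones of \<open>Function_Algebras\<close>; the product is the matrix
  product, not the pointwise \<open>*\<close> of that theory.
\<close>

type_synonym 'a cmat = "'a \<Rightarrow> 'a \<Rightarrow> complex"

definition mat_scale :: "complex \<Rightarrow> 'a cmat \<Rightarrow> 'a cmat"
  where "mat_scale c M = (\<lambda>x y. c * M x y)"

definition diag_ind :: "'a set \<Rightarrow> 'a cmat"
  where "diag_ind Y = (\<lambda>x y. if x = y \<and> x \<in> Y then 1 else 0)"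

definition mat_alg :: "'a set \<Rightarrow> (complex, 'a cmat) module"
  where "mat_alg X =
    \<lparr> carrier = {M. \<forall>x y. x \<notin> X \<or> y \<notin> X \<longrightarrow> M x y = 0},
      mult = (\<lambda>M N x y. \<Sum>z\<in>X. M x z * N z y),
      one = diag_ind X,
      zero = 0,
      add = (+),
      smult = mat_scale \<rparr>"

lemma ring_mat_alg:
  assumes "finite X"
  shows "ring (mat_alg X)"
proof (rule ringI)
  show "abelian_group (mat_alg X)"
  proof (rule abelian_groupI)
    fix M assume "M \<in> carrier (mat_alg X)"
    then have "- M \<in> carrier (mat_alg X)" "- M \<oplus>\<^bsub>mat_alg X\<^esub> M = \<zero>\<^bsub>mat_alg X\<^esub>"
      by (auto simp: mat_alg_def)
    then show "\<exists>N\<in>carrier (mat_alg X). N \<oplus>\<^bsub>mat_alg X\<^esub> M = \<zero>\<^bsub>mat_alg X\<^esub>"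
      by blast
  qed (auto simp: mat_alg_def add.assoc add.commute)
  show "monoid (mat_alg X)"
  proof (rule monoidI)
    fix L M N :: "'a cmat"
    have "(\<Sum>z\<in>X. (\<Sum>w\<in>X. L x w * M w z) * N z y) = (\<Sum>w\<in>X. L x w * (\<Sum>z\<in>X. M w z * N z y))"
      for x y
      unfolding sum_distrib_left sum_distrib_right
      by (subst sum.swap) (simp add: mult.assoc)
    then show "L \<otimes>\<^bsub>mat_alg X\<^esub> M \<otimes>\<^bsub>mat_alg X\<^esub> N = L \<otimes>\<^bsub>mat_alg X\<^esub> (M \<otimes>\<^bsub>mat_alg X\<^esub> N)"
      by (simp add: mat_alg_def)
  next
    fix M :: "'a cmat" assume M: "M \<in> carrier (mat_alg X)"
    have "(\<Sum>z\<in>X. diag_ind X x z * M z y) = M x y" for x y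
    proof -
      have "(\<Sum>z\<in>X. diag_ind X x z * M z y) = (\<Sum>z\<in>X. if z = x then M x y else 0)"
        by (rule sum.cong) (auto simp: diag_ind_def)
      also have "\<dots> = M x y"
        using M assms by (auto simp: mat_alg_def)
      finally show ?thesis .
    qed
    then show "\<one>\<^bsub>mat_alg X\<^esub> \<otimes>\<^bsub>mat_alg X\<^esub> M = M"
      by (simp add: mat_alg_def)
    have "(\<Sum>z\<in>X. M x z * diag_ind X z y) = M x y" for x y
    proof -
      have "(\<Sum>z\<in>X. M x z * diag_ind X z y) = (\<Sum>z\<in>X. if z = y then M x y else 0)"
        by (rule sum.cong) (auto simp: diag_ind_def)
      also have "\<dots> = M x y"
        using M assms by (auto simp: mat_alg_def)
      finally show ?thesis .
    qed
    then show "M \<otimes>\<^bsub>mat_alg X\<^esub> \<one>\<^bsub>mat_alg X\<^esub> = M"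
      by (simp add: mat_alg_def)
  qed (auto simp: mat_alg_def diag_ind_def)
qed (simp_all add: mat_alg_def plus_fun_def distrib_left distrib_right sum.distrib)

lemma vector_space_mat_scale: "vector_space mat_scale"
  by unfold_locales (auto simp: mat_scale_def fun_eq_iff algebra_simps)

definition mat_dim :: "'a cmat set \<Rightarrow> nat"
  where "mat_dim S = vector_space.dim mat_scale S"


section \<open>Subalgebras, direct sums and isomorphisms of complex algebras\<close>

definition unital_subalgebra :: "'v set \<Rightarrow> (complex, 'v) module \<Rightarrow> bool"
  where "unital_subalgebra B R \<longleftrightarrow> subring B R \<and> (\<forall>c. \<forall>v\<in>B. c \<odot>\<^bsub>R\<^esub> v \<in> B)"

definition gen_subalgebra :: "(complex, 'v) module \<Rightarrow> 'v set \<Rightarrow> 'v set"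
  where "gen_subalgebra R S = (\<lambda>B. unital_subalgebra B R) hull S"

definition complex_alg :: "(complex, complex) module"
  where "complex_alg =
    \<lparr> carrier = UNIV, mult = (*), one = 1, zero = 0, add = (+), smult = (*) \<rparr>"

definition alg_dirsum ::
    "(complex, 'v) module \<Rightarrow> (complex, 'w) module \<Rightarrow> (complex, 'v \<times> 'w) module"
    (infixr \<open>\<oplus>\<^sub>a\<close> 65)
  where "A \<oplus>\<^sub>a B =
    ring.extend (RDirProd A B) (module.fields (\<lambda>c (v, w). (c \<odot>\<^bsub>A\<^esub> v, c \<odot>\<^bsub>B\<^esub> w)))"

lemma alg_dirsum_sel:
  "carrier (A \<oplus>\<^sub>a B) = carrier A \<times> carrier B"
  "(v, w) \<otimes>\<^bsub>A \<oplus>\<^sub>a B\<^esub> (v', w') = (v \<otimes>\<^bsub>A\<^esub> v', w \<otimes>\<^bsub>B\<^esub> w')"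
  "\<one>\<^bsub>A \<oplus>\<^sub>a B\<^esub> = (\<one>\<^bsub>A\<^esub>, \<one>\<^bsub>B\<^esub>)"
  "\<zero>\<^bsub>A \<oplus>\<^sub>a B\<^esub> = (\<zero>\<^bsub>A\<^esub>, \<zero>\<^bsub>B\<^esub>)"
  "(v, w) \<oplus>\<^bsub>A \<oplus>\<^sub>a B\<^esub> (v', w') = (v \<oplus>\<^bsub>A\<^esub> v', w \<oplus>\<^bsub>B\<^esub> w')"
  "c \<odot>\<^bsub>A \<oplus>\<^sub>a B\<^esub> (v, w) = (c \<odot>\<^bsub>A\<^esub> v, c \<odot>\<^bsub>B\<^esub> w)"
  by (simp_all add: alg_dirsum_def RDirProd_def DirProd_def
      monoid.defs ring.defs module.defs)

definition alg_iso :: "(complex, 'v) module \<Rightarrow> (complex, 'w) module \<Rightarrow> bool"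
    (infix \<open>\<cong>\<^sub>a\<close> 50)
  where "A \<cong>\<^sub>a B \<longleftrightarrow>
    (\<exists>f \<in> ring_iso A B. \<forall>c. \<forall>v \<in> carrier A. f (c \<odot>\<^bsub>A\<^esub> v) = c \<odot>\<^bsub>B\<^esub> f v)"

text \<open>A set of matrices indexed by \<open>X\<close>, with the operations of the full matrix algebra.\<close>

definition as_alg :: "'a set \<Rightarrow> 'a cmat set \<Rightarrow> (complex, 'a cmat) module"
  where "as_alg X S = (mat_alg X)\<lparr>carrier := S\<rparr>"


section \<open>Finite connected simple graphs\<close>

text \<open>A graph is a pair of a vertex set and a set of edges, the edges being two-element subsets.\<close>

type_synonym 'a sgraph = "'a set \<times> 'a set set"

abbreviation vertices :: "'a sgraph \<Rightarrow> 'a set" where "vertices \<Gamma> \<equiv> fst \<Gamma>"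
abbreviation edges :: "'a sgraph \<Rightarrow> 'a set set" where "edges \<Gamma> \<equiv> snd \<Gamma>"

definition adjacency :: "'a sgraph \<Rightarrow> ('a \<times> 'a) set"
  where "adjacency \<Gamma> = {(x, y). {x, y} \<in> edges \<Gamma>}"

definition fin_conn_simple_graph :: "'a sgraph \<Rightarrow> bool"
  where "fin_conn_simple_graph \<Gamma> \<longleftrightarrow>
    finite (vertices \<Gamma>) \<and> vertices \<Gamma> \<noteq> {} \<and>
    (\<forall>e \<in> edges \<Gamma>. e \<subseteq> vertices \<Gamma> \<and> card e = 2) \<and>
    (\<forall>x \<in> vertices \<Gamma>. \<forall>y \<in> vertices \<Gamma>. (x, y) \<in> (adjacency \<Gamma>)\<^sup>*)"

definition adj_matrix :: "'a sgraph \<Rightarrow> 'a cmat"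
  where "adj_matrix \<Gamma> = (\<lambda>x y. if (x, y) \<in> adjacency \<Gamma> then 1 else 0)"

text \<open>The length of a shortest walk; meaningful for vertices of a connected graph.\<close>

definition graph_dist :: "'a sgraph \<Rightarrow> 'a \<Rightarrow> 'a \<Rightarrow> nat"
  where "graph_dist \<Gamma> x y = (LEAST k. (x, y) \<in> adjacency \<Gamma> ^^ k)"

definition dist_layer :: "'a sgraph \<Rightarrow> 'a \<Rightarrow> nat \<Rightarrow> 'a set"
  where "dist_layer \<Gamma> x0 k = {x \<in> vertices \<Gamma>. graph_dist \<Gamma> x0 x = k}"

definition eccentricity :: "'a sgraph \<Rightarrow> 'a \<Rightarrow> nat"
  where "eccentricity \<Gamma> x0 = Max (graph_dist \<Gamma> x0 ` vertices \<Gamma>)"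

definition graph_aut :: "'a sgraph \<Rightarrow> ('a \<Rightarrow> 'a) set"
  where "graph_aut \<Gamma> =
    {\<sigma>. \<sigma> permutes vertices \<Gamma> \<and>
         (\<forall>x \<in> vertices \<Gamma>. \<forall>y \<in> vertices \<Gamma>. {\<sigma> x, \<sigma> y} \<in> edges \<Gamma> \<longleftrightarrow> {x, y} \<in> edges \<Gamma>)}"

definition aut_stab :: "'a sgraph \<Rightarrow> 'a \<Rightarrow> ('a \<Rightarrow> 'a) set"
  where "aut_stab \<Gamma> x0 = {\<sigma> \<in> graph_aut \<Gamma>. \<sigma> x0 = x0}"

definition stab_orbits :: "'a sgraph \<Rightarrow> 'a \<Rightarrow> 'a set set"
  where "stab_orbits \<Gamma> x0 = (\<lambda>x. {\<sigma> x | \<sigma>. \<sigma> \<in> aut_stab \<Gamma> x0}) ` vertices \<Gamma>"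


section \<open>The four algebras attached to a graph with a base vertex\<close>

definition T1 :: "'a sgraph \<Rightarrow> 'a \<Rightarrow> 'a cmat set"
  where "T1 \<Gamma> x0 = gen_subalgebra (mat_alg (vertices \<Gamma>)) {adj_matrix \<Gamma>, diag_ind {x0}}"

definition T2 :: "'a sgraph \<Rightarrow> 'a \<Rightarrow> 'a cmat set"
  where "T2 \<Gamma> x0 = gen_subalgebra (mat_alg (vertices \<Gamma>))
    (insert (adj_matrix \<Gamma>) {diag_ind (dist_layer \<Gamma> x0 k) | k. k \<le> eccentricity \<Gamma> x0})"

definition T3 :: "'a sgraph \<Rightarrow> 'a \<Rightarrow> 'a cmat set"
  where "T3 \<Gamma> x0 = gen_subalgebra (mat_alg (vertices \<Gamma>))
    (insert (adj_matrix \<Gamma>) {diag_ind Y | Y. Y \<in> stab_orbits \<Gamma> x0})"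

definition T4 :: "'a sgraph \<Rightarrow> 'a \<Rightarrow> 'a cmat set"
  where "T4 \<Gamma> x0 =
    {M \<in> carrier (mat_alg (vertices \<Gamma>)).
       \<forall>x \<in> vertices \<Gamma>. \<forall>y \<in> vertices \<Gamma>. \<forall>\<sigma> \<in> aut_stab \<Gamma> x0. M (\<sigma> x) (\<sigma> y) = M x y}"


section \<open>The graphs of the family\<close>

definition Delta_graph :: "nat \<Rightarrow> nat sgraph"
  where "Delta_graph n =
    ({1..n},
     {{1, 2}, {2, 3}, {3, 4}} \<union> {{i, 5} | i. i \<in> {1, 2, 3, 4}}
       \<union> {{j, j + 1} | j. 5 \<le> j \<and> j \<le> n - 1})"

lemma fin_conn_simple_graph_Delta:
  assumes "n \<ge> 5"
  shows "fin_conn_simple_graph (Delta_graph n)"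
proof -
  let ?R = "adjacency (Delta_graph n)"
  have sym: "sym ?R"
    by (auto simp: sym_def adjacency_def insert_commute)
  have to5: "(x, 5) \<in> ?R\<^sup>*" if "x \<in> {1..n}" for x
  proof (cases "x \<le> 5")
    case True
    then have "x \<in> {1, 2, 3, 4} \<or> x = 5" using that by auto
    moreover have "(x, 5) \<in> ?R" if "x \<in> {1, 2, 3, 4}"
      using that by (auto simp: adjacency_def Delta_graph_def)
    ultimately show ?thesis by blast
  next
    case False
    then have "5 \<le> x" by simp
    then show ?thesis using that
    proof (induction x rule: dec_induct)
      case (step m)
      then have "5 \<le> m \<and> m \<le> n - 1"
        by auto
      then have "{m, m + 1} \<in> {{j, j + 1} | j. 5 \<le> j \<and> j \<le> n - 1}"
        by blast
      then have "{m, m + 1} \<in> edges (Delta_graph n)"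
        by (simp add: Delta_graph_def)
      then have "(Suc m, m) \<in> ?R"
        by (simp add: adjacency_def insert_commute)
      moreover have "(m, 5) \<in> ?R\<^sup>*"
        using step by simp
      ultimately show ?case
        by (rule converse_rtrancl_into_rtrancl)
    qed simp
  qed
  have "(x, y) \<in> ?R\<^sup>*" if "x \<in> {1..n}" "y \<in> {1..n}" for x y
    using to5[OF that(1)] to5[OF that(2)] sym_rtrancl[OF sym]
    by (meson rtrancl_trans symD)
  moreover have "e \<subseteq> {1..n} \<and> card e = 2" if "e \<in> edges (Delta_graph n)" for e
    using that assms by (auto simp: Delta_graph_def card_insert_if)
  ultimately show ?thesis
    using assms by (auto simp: fin_conn_simple_graph_def Delta_graph_def)
qed

end

theory Submission
  imports Defs
begin

text \<open>
  The stabiliser of the base vertex \<open>n\<close> is generated by the reflection \<open>(1 4)(2 3)\<close>, so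
  \<open>T4\<close> consists of the reflection-invariant matrices. These split into a block on the \<open>n - 2\<close>
  dimensional space of symmetric vectors and a block on the span of \<open>e\<^sub>1 - e\<^sub>4\<close> and
  \<open>e\<^sub>2 - e\<^sub>3\<close>. Since \<open>e\<^sub>n\<close> is a cyclic vector of \<open>A\<close> on the symmetric vectors and
  \<open>E\<^sub>n\<close> is the rank-one matrix \<open>e\<^sub>n e\<^sub>n\<^sup>T\<close>, each of the algebras contains the full symmetric
  block. On the antisymmetric block \<open>A\<close> acts as \<open>((0, 1), (1, -1))\<close>, which has two distinct
  eigenvalues. The vertices \<open>1, 2, 3, 4\<close> form a single distance layer, whose projection is the
  identity there, so \<open>T1\<close> and \<open>T2\<close> yield only \<open>\<complex> \<oplus> \<complex>\<close>; the orbit \<open>{1, 4}\<close> adds the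
  projection \<open>diag(1, 0)\<close>, and \<open>T3\<close> yields all of \<open>M\<^sub>2(\<complex>)\<close>.
\<close>


section \<open>Matrix algebras\<close>

lemma mat_alg_sel:
  "carrier (mat_alg X) = {M. \<forall>x y. x \<notin> X \<or> y \<notin> X \<longrightarrow> M x y = 0}"
  "M \<otimes>\<^bsub>mat_alg X\<^esub> N = (\<lambda>x y. \<Sum>z\<in>X. M x z * N z y)"
  "\<one>\<^bsub>mat_alg X\<^esub> = diag_ind X"
  "\<zero>\<^bsub>mat_alg X\<^esub> = 0"
  "M \<oplus>\<^bsub>mat_alg X\<^esub> N = M + N"
  "c \<odot>\<^bsub>mat_alg X\<^esub> M = mat_scale c M"
  by (simp_all add: mat_alg_def)

lemma mat_alg_outside:
  "M \<in> carrier (mat_alg X) \<Longrightarrow> x \<notin> X \<or> y \<notin> X \<Longrightarrow> M x y = 0"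
  by (auto simp: mat_alg_sel)

lemma mat_scale_apply: "mat_scale c M x y = c * M x y"
  by (simp add: mat_scale_def)

lemma complex_alg_sel:
  "carrier complex_alg = UNIV"
  "a \<otimes>\<^bsub>complex_alg\<^esub> b = a * b"
  "\<one>\<^bsub>complex_alg\<^esub> = 1"
  "\<zero>\<^bsub>complex_alg\<^esub> = 0"
  "a \<oplus>\<^bsub>complex_alg\<^esub> b = a + b"
  "a \<odot>\<^bsub>complex_alg\<^esub> b = a * b"
  by (simp_all add: complex_alg_def)

lemma as_alg_sel:
  "carrier (as_alg X S) = S"
  "mult (as_alg X S) = mult (mat_alg X)"
  "one (as_alg X S) = one (mat_alg X)"
  "zero (as_alg X S) = zero (mat_alg X)"
  "add (as_alg X S) = add (mat_alg X)"
  "smult (as_alg X S) = smult (mat_alg X)"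
  by (simp_all add: as_alg_def)

lemma mat_alg_uminus:
  assumes "finite X" "M \<in> carrier (mat_alg X)"
  shows "\<ominus>\<^bsub>mat_alg X\<^esub> M = - M"
proof -
  interpret ring "mat_alg X" by (rule ring_mat_alg[OF assms(1)])
  show ?thesis
    using assms by (intro minus_equality) (auto simp: mat_alg_sel)
qed

lemma unital_subalgebra_mat_algI:
  assumes "finite X" "B \<subseteq> carrier (mat_alg X)" "diag_ind X \<in> B"
    and "\<And>M N. M \<in> B \<Longrightarrow> N \<in> B \<Longrightarrow> M + N \<in> B"
    and "\<And>M N. M \<in> B \<Longrightarrow> N \<in> B \<Longrightarrow> M \<otimes>\<^bsub>mat_alg X\<^esub> N \<in> B"
    and scale: "\<And>c M. M \<in> B \<Longrightarrow> mat_scale c M \<in> B"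
  shows "unital_subalgebra B (mat_alg X)"
proof -
  interpret ring "mat_alg X" by (rule ring_mat_alg[OF assms(1)])
  have "- M \<in> B" if "M \<in> B" for M
    using scale[OF that, of "-1"] by (simp add: mat_scale_def fun_Compl_def)
  then have "subring B (mat_alg X)"
    using assms by (intro subringI) (auto simp: mat_alg_uminus mat_alg_sel(3,5))
  then show ?thesis
    using scale by (simp add: unital_subalgebra_def mat_alg_sel)
qed

lemma unital_subalgebra_mat_algD:
  assumes "unital_subalgebra B (mat_alg X)"
  shows "B \<subseteq> carrier (mat_alg X)" "diag_ind X \<in> B"
    and "M \<in> B \<Longrightarrow> N \<in> B \<Longrightarrow> M + N \<in> B"
    and "M \<in> B \<Longrightarrow> N \<in> B \<Longrightarrow> M \<otimes>\<^bsub>mat_alg X\<^esub> N \<in> B"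
    and "M \<in> B \<Longrightarrow> mat_scale c M \<in> B"
  using assms subringE[of B "mat_alg X"] unfolding unital_subalgebra_def
  by (simp_all add: mat_alg_sel)

lemma unital_subalgebra_sum:
  assumes "unital_subalgebra B (mat_alg X)" "\<And>i. i \<in> I \<Longrightarrow> f i \<in> B"
  shows "sum f I \<in> B"
proof -
  have "mat_scale 0 (diag_ind X) \<in> B"
    using unital_subalgebra_mat_algD[OF assms(1)] by blast
  then have "0 \<in> B"
    by (simp add: mat_scale_def zero_fun_def)
  then show ?thesis
    using assms(2) unital_subalgebra_mat_algD(3)[OF assms(1)]
    by (induction I rule: infinite_finite_induct) auto
qed

lemma gen_subalgebra_least:
  "unital_subalgebra B R \<Longrightarrow> S \<subseteq> B \<Longrightarrow> gen_subalgebra R S \<subseteq> B"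
  unfolding gen_subalgebra_def by (simp add: hull_minimal)

lemma subset_gen_subalgebraI:
  assumes "\<And>B. unital_subalgebra B R \<Longrightarrow> S \<subseteq> B \<Longrightarrow> V \<subseteq> B"
  shows "V \<subseteq> gen_subalgebra R S"
  using assms by (auto simp: gen_subalgebra_def hull_def)

lemma sum_mat_apply: "(sum f I :: 'a cmat) x y = (\<Sum>i\<in>I. f i x y)"
  by (induction I rule: infinite_finite_induct) auto

text \<open>A dual-basis criterion. Biorthogonality of \<open>b\<close> and \<open>\<phi>\<close>
  gives independence. An element of \<open>S\<close> minus its expansion in \<open>b\<close> is
  killed by all functionals, so \<open>ker\<close> gives spanning.\<close>

lemma mat_dim_eq_card:
  fixes b :: "'i \<Rightarrow> 'a cmat"
  assumes fin: "finite I"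
    and sub: "module.subspace mat_scale S"
    and b: "\<And>i. i \<in> I \<Longrightarrow> b i \<in> S"
    and add: "\<And>i M N. i \<in> I \<Longrightarrow> \<phi> i (M + N) = \<phi> i M + \<phi> i N"
    and scale: "\<And>i c M. i \<in> I \<Longrightarrow> \<phi> i (mat_scale c M) = c * \<phi> i M"
    and dual: "\<And>i j. i \<in> I \<Longrightarrow> j \<in> I \<Longrightarrow> \<phi> i (b j) = (if i = j then 1 else 0)"
    and ker: "\<And>M. M \<in> S \<Longrightarrow> (\<And>i. i \<in> I \<Longrightarrow> \<phi> i M = 0) \<Longrightarrow> M = 0"
  shows "mat_dim S = card I"
proof -
  interpret vector_space "mat_scale :: complex \<Rightarrow> 'a cmat \<Rightarrow> 'a cmat"
    by (rule vector_space_mat_scale)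
  have zero: "\<phi> i 0 = 0" if "i \<in> I" for i
    using scale[OF that, of 0 0] by simp
  have comb: "\<phi> i (\<Sum>j\<in>J. mat_scale (c j) (b j)) = (if i \<in> J then c i else 0)"
    if "i \<in> I" "J \<subseteq> I" for i J c
  proof -
    have "finite J"
      using fin that(2) finite_subset by blast
    then show ?thesis
      using that(2) by (induction J) (auto simp: add scale dual zero that(1))
  qed
  have inj: "inj_on b I"
    using dual by (metis inj_onI one_neq_zero)
  have "independent (b ` I)"
    unfolding dependent_finite[OF finite_imageI[OF fin]]
  proof safe
    fix c i assume c: "(\<Sum>v\<in>b ` I. mat_scale (c v) v) = 0" and i: "i \<in> I" "c (b i) \<noteq> 0"
    have "(\<Sum>j\<in>I. mat_scale (c (b j)) (b j)) = 0"
      using c by (simp add: sum.reindex[OF inj])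
    then show False
      using comb[OF i(1) subset_refl, of "c \<circ> b"] zero i by simp
  qed
  moreover have "S \<subseteq> span (b ` I)"
  proof
    fix M assume M: "M \<in> S"
    let ?L = "\<Sum>j\<in>I. mat_scale (\<phi> j M) (b j)"
    have L: "?L \<in> S"
      using sub b by (intro subspace_sum subspace_scale) auto
    have "\<phi> i (M - ?L) = 0" if "i \<in> I" for i
    proof -
      have "\<phi> i M = \<phi> i (M - ?L) + \<phi> i ?L"
        using add[OF that, of "M - ?L" ?L] by simp
      then show ?thesis
        using comb[OF that subset_refl, of "\<lambda>j. \<phi> j M"] that by simp
    qed
    then have "M - ?L = 0"
      using ker subspace_diff[OF sub M L] by blast
    then have "M = ?L"
      by simp
    moreover have "?L \<in> span (b ` I)"
      by (intro span_sum span_scale span_base) auto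
    ultimately show "M \<in> span (b ` I)"
      by simp
  qed
  moreover have "b ` I \<subseteq> S"
    using b by auto
  ultimately have "dim S = card (b ` I)"
    by (intro dim_unique[where B = "b ` I"]) auto
  then show ?thesis
    by (simp add: mat_dim_def card_image[OF inj])
qed


section \<open>The reflection and its symmetric and antisymmetric blocks\<close>

definition flip :: "nat \<Rightarrow> nat"
  where "flip x = (if x \<in> {1..4} then 5 - x else x)"

text \<open>The orbits \<open>{1, 4}\<close>, \<open>{2, 3}\<close>, \<open>{5}\<close>, \<open>{6}\<close> etc. of \<open>flip\<close> are numbered consecutively
  from \<open>1\<close>.\<close>

definition orb :: "nat \<Rightarrow> nat"
  where "orb x = (if x = 1 \<or> x = 4 then 1 else if x = 2 \<or> x = 3 then 2 else x - 2)"

definition orbit :: "nat \<Rightarrow> nat \<Rightarrow> nat set"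
  where "orbit n k = {y \<in> {1..n}. orb y = k}"

text \<open>A section of \<open>orb\<close> that picks the smallest vertex of each orbit.\<close>

definition rep :: "nat \<Rightarrow> nat"
  where "rep k = (if k \<le> 2 then k else k + 2)"

text \<open>The condition ranges over all naturals and not only over vertices. For
  \<open>n \<ge> 5\<close> this makes no difference: entries off the vertex set vanish and
  \<open>flip\<close> preserves that set.\<close>

definition flip_inv :: "nat \<Rightarrow> nat cmat set"
  where "flip_inv n = {M \<in> carrier (mat_alg {1..n}). \<forall>x y. M (flip x) (flip y) = M x y}"

text \<open>The action on the flip-symmetric vectors in the basis of orbit indicators, and on the
  flip-antisymmetric vectors in the basis \<open>e\<^sub>1 - e\<^sub>4, e\<^sub>2 - e\<^sub>3\<close>.\<close>

definition sym_block :: "nat \<Rightarrow> nat cmat \<Rightarrow> nat cmat"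
  where "sym_block n M = (\<lambda>i j. \<Sum>y \<in> orbit n j. M (rep i) y)"

definition anti_block :: "nat cmat \<Rightarrow> nat cmat"
  where "anti_block M = (\<lambda>i j. if i \<in> {1..2} \<and> j \<in> {1..2} then M i j - M i (5 - j) else 0)"

text \<open>The inverse of taking both blocks. An entry of \<open>P\<close> stands for a sum over an
  orbit of columns, so it is shared equally among the columns of that orbit. The signs are the
  coordinates of \<open>e\<^sub>1 - e\<^sub>4\<close> and \<open>e\<^sub>2 - e\<^sub>3\<close>; they
  are irrelevant for vertices from 5 on, where a \<open>Q\<close> supported on \<open>{1..2}\<close>
  vanishes.\<close>

definition assemble :: "nat cmat \<Rightarrow> nat cmat \<Rightarrow> nat cmat"
  where "assemble P Q = (\<lambda>x y. P (orb x) (orb y) / (if y \<le> 4 then 2 else 1)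
    + (if x \<le> 2 then 1 else -1) * (if y \<le> 2 then 1 else -1) * Q (orb x) (orb y) / 2)"

lemma flip_flip [simp]: "flip (flip x) = x"
  by (auto simp: flip_def)

lemma flip_in_iff: "n \<ge> 5 \<Longrightarrow> flip x \<in> {1..n} \<longleftrightarrow> x \<in> {1..n}"
  by (auto simp: flip_def)

lemma flip_simps: "flip (Suc 0) = 4" "flip 1 = 4" "flip 2 = 3" "flip 3 = 2" "flip 4 = 1" "x \<ge> 5 \<Longrightarrow> flip x = x"
  by (auto simp: flip_def)

lemma orb_flip: "orb (flip x) = orb x"
  by (auto simp: flip_def orb_def)

lemma orb_in: "n \<ge> 5 \<Longrightarrow> orb x \<in> {1..n - 2} \<longleftrightarrow> x \<in> {1..n}"
  by (auto simp: orb_def)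

lemma orb_le2: "orb x \<in> {1..2} \<longleftrightarrow> x \<in> {1, 2, 3, 4}"
  by (auto simp: orb_def)

lemma rep_in: "n \<ge> 5 \<Longrightarrow> rep i \<in> {1..n} \<longleftrightarrow> i \<in> {1..n - 2}"
  by (auto simp: rep_def)

lemma rep_orb: "rep (orb x) = x \<or> rep (orb x) = flip x"
  by (auto simp: rep_def orb_def flip_def)

lemma orb_rep: "orb (rep i) = i"
  by (auto simp: rep_def orb_def)

lemma orbit_set:
  assumes "n \<ge> 5"
  shows "orbit n (Suc 0) = {1, 4}" "orbit n 2 = {2, 3}"
    "5 \<le> x \<Longrightarrow> x \<le> n \<Longrightarrow> orbit n (x - 2) = {x}"
    "k \<notin> {1..n - 2} \<Longrightarrow> orbit n k = {}"
  using assms by (auto simp: orbit_def orb_def split: if_splits)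

lemma flip_invD:
  assumes "M \<in> flip_inv n"
  shows "M (flip x) (flip y) = M x y" "M (flip x) y = M x (flip y)"
    and "x \<notin> {1..n} \<Longrightarrow> M x y = 0" "y \<notin> {1..n} \<Longrightarrow> M x y = 0"
proof -
  show *: "M (flip x) (flip y) = M x y" for x y
    using assms by (auto simp: flip_inv_def)
  show "M (flip x) y = M x (flip y)"
    using *[of x "flip y"] by simp
qed (use assms in \<open>auto simp: flip_inv_def mat_alg_sel\<close>)

lemma sum_vertices:
  fixes n :: nat
  assumes "n \<ge> 5"
  shows "(\<Sum>z\<in>{1..n}. f z) = f 1 + f 2 + f 3 + f 4 + (\<Sum>z\<in>{5..n}. (f z :: complex))"
proof -
  have "{1..n} = {1, 2, 3, 4} \<union> {5..n}"
    using assms by auto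
  then show ?thesis
    by (simp add: sum.union_disjoint add.assoc)
qed

section \<open>Linearity and multiplicativity of the two blocks\<close>

lemma sym_block_add: "sym_block n (M + N) = sym_block n M + sym_block n N"
  by (simp add: sym_block_def fun_eq_iff sum.distrib)

lemma sym_block_scale: "sym_block n (mat_scale c M) = mat_scale c (sym_block n M)"
  by (simp add: sym_block_def fun_eq_iff mat_scale_def sum_distrib_left)

lemma anti_block_add: "anti_block (M + N) = anti_block M + anti_block N"
  by (simp add: anti_block_def fun_eq_iff)

lemma anti_block_scale: "anti_block (mat_scale c M) = mat_scale c (anti_block M)"
  by (simp add: anti_block_def fun_eq_iff mat_scale_def algebra_simps)

lemma sym_block_carrier:
  assumes "n \<ge> 5" "M \<in> flip_inv n"
  shows "sym_block n M \<in> carrier (mat_alg {1..n - 2})"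
proof -
  have "sym_block n M i j = 0" if "i \<notin> {1..n - 2} \<or> j \<notin> {1..n - 2}" for i j
    unfolding sym_block_def
    using that rep_in[OF assms(1), of i] orbit_set(4)[OF assms(1)] flip_invD(3)[OF assms(2)]
    by (intro sum.neutral) blast
  then show ?thesis
    by (simp add: mat_alg_sel)
qed

lemma anti_block_carrier: "anti_block M \<in> carrier (mat_alg {1..2})"
  by (auto simp: mat_alg_sel anti_block_def)

text \<open>The orbits form an equitable partition: sums of an invariant matrix over an orbit of
  columns are constant along each orbit of rows. Grouping the inner index of the product by orbits
  then gives the product of the quotient matrices.\<close>

lemma sym_block_mult:
  assumes "n \<ge> 5" "M \<in> flip_inv n" "N \<in> flip_inv n"
  shows "sym_block n (M \<otimes>\<^bsub>mat_alg {1..n}\<^esub> N)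
    = sym_block n M \<otimes>\<^bsub>mat_alg {1..n - 2}\<^esub> sym_block n N"
proof (intro ext)
  fix i j
  let ?O = "orbit n"
  have flip_O: "flip ` ?O j = ?O j"
  proof -
    have "flip ` ?O j \<subseteq> ?O j"
      using flip_in_iff[OF assms(1)] by (auto simp: orbit_def orb_flip simp del: atLeastAtMost_iff)
    moreover have "?O j = flip ` flip ` ?O j"
      by (simp add: image_image)
    ultimately show ?thesis
      by blast
  qed
  \<comment> \<open>The representative of the orbit of \<open>z\<close> is \<open>z\<close> or
    \<open>flip z\<close>, and moving the flip to the column index only permutes the orbit.\<close>
  have row: "(\<Sum>y\<in>?O j. N (rep (orb z)) y) = (\<Sum>y\<in>?O j. N z y)" for z
  proof -
    have "(\<Sum>y\<in>?O j. N (flip z) y) = (\<Sum>y\<in>?O j. N z (flip y))"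
      by (simp add: flip_invD(2)[OF assms(3)])
    also have "\<dots> = (\<Sum>y\<in>flip ` ?O j. N z y)"
      by (subst sum.reindex) (auto intro: inj_on_inverseI[of _ flip])
    finally show ?thesis
      using rep_orb[of z] flip_O by auto
  qed
  have "sym_block n (M \<otimes>\<^bsub>mat_alg {1..n}\<^esub> N) i j
      = (\<Sum>z\<in>{1..n}. M (rep i) z * (\<Sum>y\<in>?O j. N z y))"
    unfolding sym_block_def mat_alg_sel sum_distrib_left by (rule sum.swap)
  also have "\<dots> = (\<Sum>z\<in>{1..n}. M (rep i) z * sym_block n N (orb z) j)"
    by (simp add: sym_block_def row)
  also have "\<dots> = (\<Sum>k\<in>{1..n - 2}. \<Sum>z\<in>?O k. M (rep i) z * sym_block n N (orb z) j)"
    unfolding orbit_def using orb_in[OF assms(1)]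
    by (intro sum.group[symmetric]) (auto simp del: atLeastAtMost_iff)
  also have "\<dots> = (\<Sum>k\<in>{1..n - 2}. sym_block n M i k * sym_block n N k j)"
    by (intro sum.cong refl) (simp add: sym_block_def[of n M] sum_distrib_right orbit_def)
  finally show "sym_block n (M \<otimes>\<^bsub>mat_alg {1..n}\<^esub> N) i j
      = (sym_block n M \<otimes>\<^bsub>mat_alg {1..n - 2}\<^esub> sym_block n N) i j"
    by (simp add: mat_alg_sel)
qed

text \<open>Invariant matrices map antisymmetric vectors to antisymmetric vectors. Such a vector
  vanishes from 5 on and is determined by its values at 1 and 2, so the sum over all vertices
  collapses to a sum over two indices.\<close>

lemma anti_block_mult:
  assumes "n \<ge> 5" "M \<in> flip_inv n" "N \<in> flip_inv n"
  shows "anti_block (M \<otimes>\<^bsub>mat_alg {1..n}\<^esub> N)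
    = anti_block M \<otimes>\<^bsub>mat_alg {1..2}\<^esub> anti_block N"
proof (intro ext)
  fix i j :: nat
  consider "i \<notin> {1..2} \<or> j \<notin> {1..2}" | "i \<in> {1..2}" "j \<in> {1..2}"
    by blast
  then show "anti_block (M \<otimes>\<^bsub>mat_alg {1..n}\<^esub> N) i j
    = (anti_block M \<otimes>\<^bsub>mat_alg {1..2}\<^esub> anti_block N) i j"
  proof cases
    case 1
    then show ?thesis
      by (auto simp: anti_block_def mat_alg_sel)
  next
    case 2
    \<comment> \<open>The image under \<open>N\<close> of the antisymmetric basis vector with index
      \<open>j\<close>.\<close>
    define d where "d z = N z j - N z (5 - j)" for z
    have d: "d (flip z) = - d z" for z
      using flip_invD(2)[OF assms(3), of z j] flip_invD(1)[OF assms(3), of z j] 2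
      by (auto simp: d_def flip_def)
    have d5: "d z = 0" if "z \<ge> 5" for z
      using d[of z] that by (simp add: flip_simps)
    have d34: "d 3 = - d 2" "d 4 = - d 1"
      using d[of 2] d[of 1] by (simp_all add: flip_simps)
    have "anti_block (M \<otimes>\<^bsub>mat_alg {1..n}\<^esub> N) i j = (\<Sum>z\<in>{1..n}. M i z * d z)"
      using 2 by (simp add: anti_block_def mat_alg_sel d_def right_diff_distrib sum_subtractf)
    also have "\<dots> = (M i 1 - M i 4) * d 1 + (M i 2 - M i 3) * d 2"
      using assms(1) by (simp add: sum_vertices d5 d34 algebra_simps del: One_nat_def)
    also have "{1..2} = {1, 2::nat}"
      by auto
    then have "(M i 1 - M i 4) * d 1 + (M i 2 - M i 3) * d 2
      = (anti_block M \<otimes>\<^bsub>mat_alg {1..2}\<^esub> anti_block N) i j"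
      using 2 by (auto simp: mat_alg_sel anti_block_def d_def)
    finally show ?thesis .
  qed
qed

text \<open>If both indices lie in \<open>{1, 2, 3, 4}\<close>, the flip reverses both signs and
  their product stays. Otherwise the \<open>Q\<close> term is zero and the \<open>P\<close> term
  depends only on orbits.\<close>

lemma assemble_in:
  assumes "n \<ge> 5" "P \<in> carrier (mat_alg {1..n - 2})" "Q \<in> carrier (mat_alg {1..2})"
  shows "assemble P Q \<in> flip_inv n"
proof -
  note P = mat_alg_outside[OF assms(2)]
  note Q = mat_alg_outside[OF assms(3)]
  have Q': "Q i j = 0" if "i \<notin> {1..n-2} \<or> j \<notin> {1..n-2}" for i j
  proof -
    have "{1..2} \<subseteq> {1..n - 2}"
      using assms(1) by auto
    then show ?thesis
      using that by (intro Q) blast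
  qed
  have "assemble P Q x y = 0" if "x \<notin> {1..n} \<or> y \<notin> {1..n}" for x y
  proof -
    have "orb x \<notin> {1..n - 2} \<or> orb y \<notin> {1..n - 2}"
      using that orb_in[OF assms(1)] by blast
    then show ?thesis
      using P Q' by (simp add: assemble_def del: atLeastAtMost_iff)
  qed
  moreover have "assemble P Q (flip x) (flip y) = assemble P Q x y" for x y
  proof -
    have le4: "flip y \<le> 4 \<longleftrightarrow> y \<le> 4"
      by (auto simp: flip_def)
    consider "x \<in> {1,2,3,4}" "y \<in> {1,2,3,4}" | "x \<notin> {1,2,3,4}" | "y \<notin> {1,2,3,4}"
      by blast
    then show ?thesis
    proof cases
      case 1
      then show ?thesis
        by (elim insertE emptyE) (simp_all add: assemble_def flip_def orb_def)
    next
      case 2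
      then have "Q (orb x) (orb y) = 0"
        using orb_le2 by (intro Q) blast
      then show ?thesis
        by (simp add: assemble_def orb_flip le4)
    next
      case 3
      then have "Q (orb x) (orb y) = 0"
        using orb_le2 by (intro Q) blast
      then show ?thesis
        by (simp add: assemble_def orb_flip le4)
    qed
  qed
  ultimately show ?thesis
    by (auto simp: flip_inv_def mat_alg_sel)
qed

text \<open>On the corner indexed by 1 to 4, half the sum and half the difference of
  \<open>M x y\<close> and \<open>M x (flip y)\<close> recover the entries. If one index is at least
  5, it is fixed by the flip, so the entry is constant along the orbit of the other index and the
  symmetric block determines it.\<close>

lemma assemble_blocks:
  assumes "n \<ge> 5" "M \<in> flip_inv n"
  shows "assemble (sym_block n M) (anti_block M) = M"
proof (intro ext)
  fix x y
  have inv: "M (flip x) y = M x (flip y)" for x y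
    by (rule flip_invD(2)[OF assms(2)])
  have inv': "M 4 (Suc 0) = M (Suc 0) 4" "M 4 4 = M (Suc 0) (Suc 0)" "M 4 2 = M (Suc 0) 3"
    "M 4 3 = M (Suc 0) 2" "M 3 (Suc 0) = M 2 4" "M 3 4 = M 2 (Suc 0)" "M 3 2 = M 2 3" "M 3 3 = M 2 2"
    using inv[of 1 1] inv[of 1 2] inv[of 1 3] inv[of 1 4]
      inv[of 2 1] inv[of 2 2] inv[of 2 3] inv[of 2 4] by (simp_all add: flip_simps)
  have inv5: "y \<ge> 5 \<Longrightarrow> M (rep (orb x)) y = M x y" "x \<ge> 5 \<Longrightarrow> M x (flip y) = M x y"  for x y
    using inv[of x y] rep_orb[of x] by (auto simp: flip_simps)
  have in5: "x \<ge> 5 \<Longrightarrow> M x 4 = M x 1" "x \<ge> 5 \<Longrightarrow> M x 3 = M x 2" for x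
    using inv5(2)[of x 1] inv5(2)[of x 2] by (simp_all add: flip_simps)
  note orbs = orbit_set[OF assms(1)]
  consider "x \<notin> {1..n} \<or> y \<notin> {1..n}" | "x \<in> {1,2,3,4}" "y \<in> {1,2,3,4}" | "x \<in> {1..n}" "y \<in> {5..n}"
    | "x \<in> {5..n}" "y \<in> {1,2,3,4}"
    by fastforce
  then show "assemble (sym_block n M) (anti_block M) x y = M x y"
  proof cases
    case 1
    then show ?thesis
      using flip_invD(3,4)[OF assms(2), where x = x and y = y]
        flip_invD(3,4)[OF assemble_in[OF assms(1) sym_block_carrier[OF assms] anti_block_carrier],
          where x = x and y = y, of M]
      by auto
  next
    case 2
    have o: "orb (Suc 0) = Suc 0" "orb 4 = Suc 0" "orb 2 = 2" "orb 3 = 2"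
      by (auto simp: orb_def)
    have s: "sym_block n M i (Suc 0) = M i (Suc 0) + M i 4" "sym_block n M i 2 = M i 2 + M i 3"
      "anti_block M i (Suc 0) = M i (Suc 0) - M i 4" "anti_block M i 2 = M i 2 - M i 3"
      if "i \<in> {Suc 0, 2}" for i
      using that by (auto simp: sym_block_def anti_block_def orbs rep_def)
    from 2 show ?thesis
      by (elim insertE emptyE)
        (simp_all add: assemble_def o s inv' add_divide_distrib diff_divide_distrib)
  next
    case 3
    then have "orb y = y - 2" "y - 2 \<ge> 3"
      by (auto simp: orb_def)
    then show ?thesis
      using 3 by (simp add: assemble_def sym_block_def anti_block_def orbs inv5)
  next
    case 4
    then have "orb x > 2" "rep (orb x) = x"
      by (auto simp: orb_def rep_def)
    moreover have o: "orb (Suc 0) = Suc 0" "orb 4 = Suc 0" "orb 2 = 2" "orb 3 = 2"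
      by (auto simp: orb_def)
    moreover have "M x 4 = M x (Suc 0)" "M x 3 = M x 2"
      using 4 in5[of x] by simp_all
    moreover note 4(2)
    ultimately show ?thesis
      by (elim insertE emptyE) (simp_all add: assemble_def sym_block_def anti_block_def orbs)
  qed
qed

lemma blocks_assemble:
  assumes "n \<ge> 5" "P \<in> carrier (mat_alg {1..n - 2})" "Q \<in> carrier (mat_alg {1..2})"
  shows "sym_block n (assemble P Q) = P" "anti_block (assemble P Q) = Q"
proof -
  have o: "orb (Suc 0) = Suc 0" "orb 4 = Suc 0" "orb 2 = 2" "orb 3 = 2"
    by (auto simp: orb_def)
  note P = mat_alg_outside[OF assms(2)]
  note Q = mat_alg_outside[OF assms(3)]
  note orbs = orbit_set[OF assms(1)]
  show "sym_block n (assemble P Q) = P"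
  proof (intro ext)
    fix i j
    consider "j \<notin> {1..n-2}" | "j = 1" | "j = 2" | "j \<in> {3..n-2}"
      by fastforce
    then show "sym_block n (assemble P Q) i j = P i j"
    proof cases
      case 1
      then show ?thesis
        using P[of i j] orbs(4)[of j] unfolding sym_block_def by simp
    next
      case 4
      then have "orbit n j = {j + 2}"
        using 4 orbs(3)[of "j + 2"] by simp linarith
      then show ?thesis
        using 4 Q[of i j] by (auto simp: sym_block_def assemble_def orb_rep orb_def[of "Suc (Suc j)"])
    qed (simp_all add: sym_block_def assemble_def orb_rep orbs o)
  qed
  show "anti_block (assemble P Q) = Q"
  proof (intro ext)
    fix i j :: nat
    consider "i \<notin> {1..2} \<or> j \<notin> {1..2}" | "i \<in> {1, 2}" "j \<in> {1, 2}"
      by fastforce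
    then show "anti_block (assemble P Q) i j = Q i j"
    proof cases
      case 1
      then show ?thesis
        using Q[of i j] by (auto simp: anti_block_def)
    next
      case 2
      then show ?thesis
        by (elim insertE emptyE) (simp_all add: anti_block_def assemble_def o)
    qed
  qed
qed


section \<open>Adjacency, automorphisms and distances\<close>

text \<open>A case list on ordered pairs, so that adjacency is decided by simplification instead of
  by comparing unordered pairs.\<close>

definition dadj :: "nat \<Rightarrow> nat \<Rightarrow> nat \<Rightarrow> bool"
  where "dadj n x y \<longleftrightarrow> (x, y) \<in> {(1, 2), (2, 1), (2, 3), (3, 2), (3, 4), (4, 3)}
    \<or> x \<in> {1, 2, 3, 4} \<and> y = 5 \<or> y \<in> {1, 2, 3, 4} \<and> x = 5
    \<or> 5 \<le> x \<and> y = x + 1 \<and> y \<le> n \<or> 5 \<le> y \<and> x = y + 1 \<and> x \<le> n"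

lemma adjacency_Delta:
  assumes "n \<ge> 5"
  shows "(x, y) \<in> adjacency (Delta_graph n) \<longleftrightarrow> dadj n x y"
proof -
  have "{x, y} \<in> {{1, 2}, {2, 3}, {3, 4}}
      \<longleftrightarrow> (x, y) \<in> {(1, 2), (2, 1), (2, 3), (3, 2), (3, 4), (4, 3)}"
    by (auto simp: doubleton_eq_iff)
  moreover have "{x, y} \<in> {{i, 5} | i. i \<in> {1, 2, 3, 4}}
      \<longleftrightarrow> x \<in> {1, 2, 3, 4} \<and> y = 5 \<or> y \<in> {1, 2, 3, 4} \<and> x = 5"
    by (simp only: mem_Collect_eq doubleton_eq_iff) blast
  moreover have "{x, y} \<in> {{j, j + 1} | j. 5 \<le> j \<and> j \<le> n - 1}
      \<longleftrightarrow> (5 \<le> x \<and> y = x + 1 \<and> x \<le> n - 1) \<or> (5 \<le> y \<and> x = y + 1 \<and> y \<le> n - 1)"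
    by (simp only: mem_Collect_eq doubleton_eq_iff) blast
  moreover have "x \<le> n - 1 \<longleftrightarrow> x + 1 \<le> n" "y \<le> n - 1 \<longleftrightarrow> y + 1 \<le> n"
    using assms by linarith+
  ultimately show ?thesis
    unfolding adjacency_def Delta_graph_def dadj_def snd_conv mem_Collect_eq case_prod_conv Un_iff
    by metis
qed

lemma edges_Delta: "n \<ge> 5 \<Longrightarrow> {x, y} \<in> edges (Delta_graph n) \<longleftrightarrow> dadj n x y"
  using adjacency_Delta[of n x y] by (simp add: adjacency_def)

lemma vertices_Delta: "vertices (Delta_graph n) = {1..n}"
  by (simp add: Delta_graph_def)

lemma adj_matrix_Delta: "n \<ge> 5 \<Longrightarrow> adj_matrix (Delta_graph n) = (\<lambda>x y. if dadj n x y then 1 else 0)"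
  by (simp add: adj_matrix_def adjacency_Delta)

lemma dadj_sym: "dadj n x y \<longleftrightarrow> dadj n y x"
  unfolding dadj_def by auto

lemma dadj_in: "n \<ge> 5 \<Longrightarrow> dadj n x y \<Longrightarrow> x \<in> {1..n} \<and> y \<in> {1..n}"
  unfolding dadj_def by (elim disjE conjE insertE emptyE) simp_all

lemma dadj_flip: "dadj n (flip x) (flip y) \<longleftrightarrow> dadj n x y"
proof -
  have "dadj n (flip x) (flip y)" if "dadj n x y" for x y
    using that unfolding dadj_def[of n x y]
    by (elim disjE conjE insertE emptyE) (simp_all add: flip_def dadj_def)
  from this[of x y] this[of "flip x" "flip y"] show ?thesis
    by auto
qed

section \<open>Automorphisms fixing the base vertex\<close>

lemma flip_aut: "n \<ge> 5 \<Longrightarrow> flip \<in> aut_stab (Delta_graph n) n"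
proof -
  assume n: "n \<ge> 5"
  have "flip permutes {1..n}"
    unfolding permutes_def
  proof (intro conjI allI impI)
    show "flip x = x" if "x \<notin> {1..n}" for x
      using that n by (auto simp: flip_def)
    show "\<exists>!x. flip x = y" for y
      by (metis flip_flip)
  qed
  then show ?thesis
    using n by (simp add: aut_stab_def graph_aut_def vertices_Delta edges_Delta dadj_flip flip_simps)
qed

text \<open>A walk of three steps on the path 1-2-3-4 that never turns back must traverse it from
  end to end. This is applied to the image of the path under an automorphism.\<close>

lemma path_rigid:
  fixes a b c d :: nat
  defines "P \<equiv> {(1, 2), (2, 1), (2, 3), (3, 2), (3, 4), (4, 3)}"
  assumes "(a, b) \<in> P" "(b, c) \<in> P" "(c, d) \<in> P" "a \<noteq> c" "b \<noteq> d"
  shows "a = 1 \<and> b = 2 \<and> c = 3 \<and> d = 4 \<or> a = 4 \<and> b = 3 \<and> c = 2 \<and> d = 1"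
  using assms(2-) unfolding P_def by auto

lemma aut_stab_Delta:
  assumes "n \<ge> 5"
  shows "aut_stab (Delta_graph n) n = {id, flip}"
proof
  show "{id, flip} \<subseteq> aut_stab (Delta_graph n) n"
    using flip_aut[OF assms] by (auto simp: aut_stab_def graph_aut_def permutes_id)
  show "aut_stab (Delta_graph n) n \<subseteq> {id, flip}"
  proof
    fix \<sigma> assume "\<sigma> \<in> aut_stab (Delta_graph n) n"
    then have perm: "\<sigma> permutes {1..n}" and fix_n: "\<sigma> n = n"
      and edge': "\<forall>x\<in>{1..n}. \<forall>y\<in>{1..n}. dadj n (\<sigma> x) (\<sigma> y) \<longleftrightarrow> dadj n x y"
      unfolding aut_stab_def graph_aut_def vertices_Delta edges_Delta[OF assms] by auto
    have edge: "dadj n (\<sigma> x) (\<sigma> y)" if "dadj n x y" for x y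
      using edge' dadj_in[OF assms that] that by blast
    have inj: "\<sigma> x = \<sigma> y \<longleftrightarrow> x = y" for x y
      using permutes_inj[OF perm] by (auto dest: injD)
    \<comment> \<open>Downward induction along the tail: \<open>\<sigma> m\<close> is a neighbour of
      the fixed vertex \<open>m + 1\<close>, and its only other neighbour, \<open>m + 2\<close> if
      present, is itself fixed.\<close>
    have "\<forall>x. 5 \<le> x \<and> x \<le> n \<longrightarrow> \<sigma> x = x"
      using assms
    proof (induction rule: inc_induct)
      case base
      then show ?case
        using fix_n by auto
    next
      case (step m)
      have "dadj n m (Suc m)"
        using step by (simp add: dadj_def)
      then have "dadj n (\<sigma> m) (Suc m)"
        using edge[of m "Suc m"] step by simp
      then have "\<sigma> m = m \<or> \<sigma> m = Suc (Suc m) \<and> Suc (Suc m) \<le> n"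
        using step(1) unfolding dadj_def by auto
      moreover have "\<sigma> (Suc (Suc m)) = Suc (Suc m)" if "Suc (Suc m) \<le> n"
        using step that by simp
      ultimately have "\<sigma> m = m"
        using inj[of m "Suc (Suc m)"] by auto
      then show ?case
        using step by (metis Suc_leI le_neq_implies_less)
    qed
    then have fix5: "\<sigma> x = x" if "x \<ge> 5" for x
      using perm that by (cases "x \<le> n") (auto simp: permutes_def)
    \<comment> \<open>A larger image would be fixed by \<open>\<sigma>\<close> and so would have two
      preimages.\<close>
    have small: "\<sigma> x \<le> 4" if "x \<le> 4" for x
    proof (rule ccontr)
      assume "\<not> \<sigma> x \<le> 4"
      then have "\<sigma> (\<sigma> x) = \<sigma> x"
        by (intro fix5) simp
      then show False
        using that inj[of "\<sigma> x" x] \<open>\<not> \<sigma> x \<le> 4\<close> by simp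
    qed
    have path: "(\<sigma> x, \<sigma> y) \<in> {(1, 2), (2, 1), (2, 3), (3, 2), (3, 4), (4, 3)}"
      if "dadj n x y" "x \<le> 4" "y \<le> 4" for x y
      using edge[OF that(1)] small[OF that(2)] small[OF that(3)] unfolding dadj_def by auto
    have p: "(\<sigma> 1, \<sigma> 2) \<in> {(1, 2), (2, 1), (2, 3), (3, 2), (3, 4), (4, 3)}"
      "(\<sigma> 2, \<sigma> 3) \<in> {(1, 2), (2, 1), (2, 3), (3, 2), (3, 4), (4, 3)}"
      "(\<sigma> 3, \<sigma> 4) \<in> {(1, 2), (2, 1), (2, 3), (3, 2), (3, 4), (4, 3)}"
      by (intro path; simp add: dadj_def)+
    have "\<sigma> 1 \<noteq> \<sigma> 3" "\<sigma> 2 \<noteq> \<sigma> 4"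
      by (simp_all add: inj)
    with p have "\<sigma> 1 = 1 \<and> \<sigma> 2 = 2 \<and> \<sigma> 3 = 3 \<and> \<sigma> 4 = 4
      \<or> \<sigma> 1 = 4 \<and> \<sigma> 2 = 3 \<and> \<sigma> 3 = 2 \<and> \<sigma> 4 = 1"
      by (intro path_rigid)
    then have "(\<forall>x\<in>{1, 2, 3, 4}. \<sigma> x = x) \<or> (\<forall>x\<in>{1, 2, 3, 4}. \<sigma> x = flip x)"
      unfolding ball_simps flip_simps by blast
    moreover have "\<sigma> x = x" "flip x = x" if "x \<notin> {1, 2, 3, 4}" for x
    proof -
      have "x = 0 \<or> x \<ge> 5"
        using that by auto
      then show "\<sigma> x = x" "flip x = x"
        using fix5 perm by (auto simp: permutes_def flip_def)
    qed
    ultimately have "(\<forall>x. \<sigma> x = x) \<or> (\<forall>x. \<sigma> x = flip x)"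
      by metis
    then show "\<sigma> \<in> {id, flip}"
      by (auto simp: fun_eq_iff)
  qed
qed

lemma T4_Delta:
  assumes "n \<ge> 5"
  shows "T4 (Delta_graph n) n = flip_inv n"
proof -
  have "M (flip x) (flip y) = M x y"
    if M: "M \<in> carrier (mat_alg {1..n})"
      and inv: "\<forall>x\<in>{1..n}. \<forall>y\<in>{1..n}. M (flip x) (flip y) = M x y" for M :: "nat cmat" and x y
  proof (cases "x \<in> {1..n} \<and> y \<in> {1..n}")
    case False
    then show ?thesis
      using mat_alg_outside[OF M] flip_in_iff[OF assms] by metis
  qed (use inv in auto)
  then show ?thesis
    unfolding T4_def vertices_Delta aut_stab_Delta[OF assms] flip_inv_def by auto
qed

lemma stab_orbits_Delta:
  "n \<ge> 5 \<Longrightarrow> stab_orbits (Delta_graph n) n = (\<lambda>x. {x, flip x}) ` {1..n}"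
  unfolding stab_orbits_def vertices_Delta aut_stab_Delta by (intro image_cong) fastforce+

text \<open>The formula vanishes at \<open>n\<close> and grows by at most one along an edge, which
  bounds the length of every walk from below. Descending the tail to 5, with one more step for the
  vertices 1 to 4, attains the bound.\<close>

lemma graph_dist_Delta:
  assumes "n \<ge> 5" "y \<in> {1..n}"
  shows "graph_dist (Delta_graph n) n y = (if y \<le> 4 then n - 4 else n - y)" (is "_ = ?d y")
proof -
  let ?R = "adjacency (Delta_graph n)"
  have lower: "?d y \<le> k" if "(n, y) \<in> ?R ^^ k" for k y
    using that
  proof (induction k arbitrary: y)
    case 0
    then show ?case
      using assms(1) by simp
  next
    case (Suc k)
    then obtain z where z: "(n, z) \<in> ?R ^^ k" "dadj n z y"
      using adjacency_Delta[OF assms(1)] by auto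
    have "?d y \<le> Suc (?d z)"
      using z(2) assms(1) unfolding dadj_def by auto
    then show ?case
      using Suc.IH[OF z(1)] by linarith
  qed
  have upper5: "(n, m) \<in> ?R ^^ (n - m)" if "5 \<le> m" "m \<le> n" for m
    using that(2)
  proof (induction rule: inc_induct)
    case (step k)
    then have "(Suc k, k) \<in> ?R"
      using that(1) by (simp add: adjacency_Delta[OF assms(1)] dadj_def)
    then have "(n, k) \<in> ?R ^^ Suc (n - Suc k)"
      using step by (intro relpow_Suc_I)
    then show ?case
      using step by (simp add: Suc_diff_Suc)
  qed simp
  have "(n, y) \<in> ?R ^^ ?d y"
  proof (cases "y \<le> 4")
    case True
    then have "y \<in> {1, 2, 3, 4}"
      using assms(2) by auto
    then have "(5, y) \<in> ?R"
      by (simp add: adjacency_Delta[OF assms(1)] dadj_def)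
    then have "(n, y) \<in> ?R ^^ Suc (n - 5)"
      using upper5[of 5] assms(1) by (intro relpow_Suc_I) auto
    then show ?thesis
      using True assms(1) by (simp add: Suc_diff_le[symmetric])
  next
    case False
    then show ?thesis
      using upper5[of y] assms(2) by simp
  qed
  then show ?thesis
    unfolding graph_dist_def using lower by (intro Least_equality) auto
qed


section \<open>The four algebras inside the flip-invariant matrices\<close>

text \<open>On the antisymmetric vectors \<open>e\<^sub>1 - e\<^sub>4, e\<^sub>2 - e\<^sub>3\<close> the adjacency matrix acts as
  \<open>((0, 1), (1, -1))\<close>; the two equations below describe the span of this matrix and the identity.\<close>

definition adj_anti :: "nat \<Rightarrow> nat cmat set"
  where "adj_anti n = {M \<in> flip_inv n. anti_block M 2 1 = anti_block M 1 2
    \<and> anti_block M 2 2 = anti_block M 1 1 - anti_block M 1 2}"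

lemma diag_ind_flip_inv:
  assumes "Y \<subseteq> {1..n}" "\<And>x. flip x \<in> Y \<longleftrightarrow> x \<in> Y"
  shows "diag_ind Y \<in> flip_inv n"
proof -
  have "flip x = flip y \<longleftrightarrow> x = y" for x y
    by (metis flip_flip)
  then show ?thesis
    using assms by (auto simp: flip_inv_def mat_alg_sel diag_ind_def)
qed

lemma subalgebra_flip_inv:
  assumes "n \<ge> 5"
  shows "unital_subalgebra (flip_inv n) (mat_alg {1..n})"
proof (rule unital_subalgebra_mat_algI)
  show "diag_ind {1..n} \<in> flip_inv n"
    using flip_in_iff[OF assms] by (intro diag_ind_flip_inv) blast+
next
  fix M N assume MN: "M \<in> flip_inv n" "N \<in> flip_inv n"
  have "(\<Sum>z\<in>{1..n}. M (flip x) z * N z (flip y)) = (\<Sum>z\<in>{1..n}. M x z * N z y)" for x y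
    using flip_in_iff[OF assms]
    by (intro sum.reindex_bij_witness[of _ flip flip])
      (simp_all add: flip_invD(2)[OF MN(1)] flip_invD(2)[OF MN(2), symmetric] del: atLeastAtMost_iff)
  then show "M \<otimes>\<^bsub>mat_alg {1..n}\<^esub> N \<in> flip_inv n"
    using flip_invD(3)[OF MN(1)] flip_invD(4)[OF MN(2)]
    by (auto simp: flip_inv_def mat_alg_sel simp del: atLeastAtMost_iff)
qed (auto simp: flip_inv_def mat_alg_sel mat_scale_def)

lemma anti_block_one: "n \<ge> 5 \<Longrightarrow> anti_block (diag_ind {1..n}) = diag_ind {1..2}"
  by (auto simp: anti_block_def diag_ind_def fun_eq_iff)

lemma two_set: "{1..2} = {1, 2::nat}"
  by auto

lemma anti_block_mult_apply:
  assumes "n \<ge> 5" "M \<in> flip_inv n" "N \<in> flip_inv n"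
  shows "anti_block (M \<otimes>\<^bsub>mat_alg {1..n}\<^esub> N) i j
    = anti_block M i 1 * anti_block N 1 j + anti_block M i 2 * anti_block N 2 j"
  by (subst anti_block_mult[OF assms]) (simp only: mat_alg_sel two_set, simp)

text \<open>The matrix \<open>T = ((0, 1), (1, -1))\<close> satisfies
  \<open>T\<^sup>2 = 1 - T\<close>, so the span of the identity and \<open>T\<close> is closed under
  products; the set is its preimage under \<open>anti_block\<close>.\<close>

lemma subalgebra_adj_anti:
  assumes "n \<ge> 5"
  shows "unital_subalgebra (adj_anti n) (mat_alg {1..n})"
proof (rule unital_subalgebra_mat_algI)
  note flip = unital_subalgebra_mat_algD[OF subalgebra_flip_inv[OF assms]]
  show "adj_anti n \<subseteq> carrier (mat_alg {1..n})"
    using flip(1) by (auto simp: adj_anti_def)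
  show "diag_ind {1..n} \<in> adj_anti n"
    using flip(2) anti_block_one[OF assms] by (simp add: adj_anti_def diag_ind_def)
  fix M assume M: "M \<in> adj_anti n"
  show "mat_scale c M \<in> adj_anti n" for c
    using M flip(5) by (auto simp: adj_anti_def anti_block_scale mat_scale_apply right_diff_distrib)
  fix N assume N: "N \<in> adj_anti n"
  show "M + N \<in> adj_anti n"
    using M N flip(3) by (auto simp: adj_anti_def anti_block_add)
  show "M \<otimes>\<^bsub>mat_alg {1..n}\<^esub> N \<in> adj_anti n"
  proof -
    have inv: "M \<in> flip_inv n" "N \<in> flip_inv n"
      and eqs: "anti_block M 2 1 = anti_block M 1 2"
        "anti_block M 2 2 = anti_block M 1 1 - anti_block M 1 2"
        "anti_block N 2 1 = anti_block N 1 2"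
        "anti_block N 2 2 = anti_block N 1 1 - anti_block N 1 2"
      using M N unfolding adj_anti_def by blast+
    show ?thesis
      using flip(4)[OF inv] unfolding adj_anti_def anti_block_mult_apply[OF assms inv] mem_Collect_eq
      by (simp add: eqs algebra_simps del: One_nat_def)
  qed
qed simp

lemma adj_matrix_flip_inv:
  "n \<ge> 5 \<Longrightarrow> adj_matrix (Delta_graph n) \<in> flip_inv n"
  using dadj_in[of n] by (auto simp: flip_inv_def mat_alg_sel adj_matrix_Delta dadj_flip)

lemma anti_block_adj_matrix:
  assumes "n \<ge> 5"
  defines "N \<equiv> anti_block (adj_matrix (Delta_graph n))"
  shows "N 1 1 = 0" "N 1 2 = 1" "N 2 1 = 1" "N 2 2 = -1"
  using assms by (simp_all add: adj_matrix_Delta anti_block_def dadj_def)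

lemma anti_block_diag_ind:
  "anti_block (diag_ind Y) i j = (if i = j \<and> i \<in> {1..2} \<inter> Y then 1 else 0)"
  by (auto simp: anti_block_def diag_ind_def)

lemma T2_subset_adj_anti:
  assumes "n \<ge> 5"
  shows "T2 (Delta_graph n) n \<subseteq> adj_anti n"
  unfolding T2_def vertices_Delta
proof (intro gen_subalgebra_least[OF subalgebra_adj_anti[OF assms]] insert_subsetI subsetI)
  show "adj_matrix (Delta_graph n) \<in> adj_anti n"
    using adj_matrix_flip_inv[OF assms] anti_block_adj_matrix[OF assms] by (simp add: adj_anti_def)
next
  fix M assume "M \<in> {diag_ind (dist_layer (Delta_graph n) n k) | k. k \<le> eccentricity (Delta_graph n) n}"
  then obtain k where M: "M = diag_ind (dist_layer (Delta_graph n) n k)"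
    by auto
  let ?Y = "dist_layer (Delta_graph n) n k"
  have mem: "x \<in> ?Y \<longleftrightarrow> x \<in> {1..n} \<and> (if x \<le> 4 then n - 4 else n - x) = k" for x
    using graph_dist_Delta[OF assms, of x] by (auto simp: dist_layer_def vertices_Delta)
  have "flip x \<in> ?Y \<longleftrightarrow> x \<in> ?Y" for x
    unfolding mem flip_in_iff[OF assms] by (auto simp: flip_def)
  then have "M \<in> flip_inv n"
    unfolding M using mem by (intro diag_ind_flip_inv) blast+
  \<comment> \<open>Hence the projection onto the layer has antisymmetric block zero or the
    identity.\<close>
  moreover have "1 \<in> ?Y \<longleftrightarrow> 2 \<in> ?Y"
    unfolding mem using assms by auto
  ultimately show "M \<in> adj_anti n"
    by (simp add: adj_anti_def M anti_block_diag_ind)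
qed

lemma T3_subset_flip_inv:
  assumes "n \<ge> 5"
  shows "T3 (Delta_graph n) n \<subseteq> flip_inv n"
  unfolding T3_def vertices_Delta
proof (intro gen_subalgebra_least[OF subalgebra_flip_inv[OF assms]] insert_subsetI subsetI)
  show "adj_matrix (Delta_graph n) \<in> flip_inv n"
    by (rule adj_matrix_flip_inv[OF assms])
next
  fix M assume "M \<in> {diag_ind Y | Y. Y \<in> stab_orbits (Delta_graph n) n}"
  then obtain x where x: "x \<in> {1..n}" and M: "M = diag_ind {x, flip x}"
    by (auto simp: stab_orbits_Delta[OF assms])
  have "flip y \<in> {x, flip x} \<longleftrightarrow> y \<in> {x, flip x}" for y
    by (metis flip_flip insert_iff singletonD)
  then show "M \<in> flip_inv n"
    unfolding M using x flip_in_iff[OF assms, of x] by (intro diag_ind_flip_inv) auto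
qed

section \<open>Elements forced into a subalgebra by the generators\<close>

definition indic :: "nat set \<Rightarrow> nat \<Rightarrow> complex"
  where "indic Y = (\<lambda>x. if x \<in> Y then 1 else 0)"

definition mat_vec :: "nat \<Rightarrow> (nat \<Rightarrow> complex) \<Rightarrow> nat \<Rightarrow> complex"
  where "mat_vec n v = (\<lambda>x. \<Sum>z\<in>{1..n}. adj_matrix (Delta_graph n) x z * v z)"

lemma mat_vec_indic:
  assumes "Y \<subseteq> {1..n}"
  shows "mat_vec n (indic Y) x = (\<Sum>z\<in>Y. adj_matrix (Delta_graph n) x z)"
  unfolding mat_vec_def by (rule sum.mono_neutral_cong_right) (use assms in \<open>auto simp: indic_def\<close>)

text \<open>The base vertex is a cyclic vector of the adjacency matrix on the flip-symmetric vectors.\<close>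

lemma orbit_indicators_from_base:
  assumes n: "n \<ge> 5"
    and add: "\<And>v w. v \<in> L \<Longrightarrow> w \<in> L \<Longrightarrow> (\<lambda>x. v x + w x) \<in> L"
    and scale: "\<And>c v. v \<in> L \<Longrightarrow> (\<lambda>x. c * v x) \<in> L"
    and act: "\<And>v. v \<in> L \<Longrightarrow> mat_vec n v \<in> L"
    and base: "indic {n} \<in> L"
  shows "indic (orbit n k) \<in> L"
proof -
  have diff: "(\<lambda>x. v x - w x) \<in> L" if "v \<in> L" "w \<in> L" for v w
    using add[OF that(1) scale[OF that(2), of "-1"]] by simp
  have zero: "(\<lambda>x. 0) \<in> L"
    using scale[OF base, of 0] by simp
  have L_cong: "w \<in> L" if "v \<in> L" "\<And>x. v x = w x" for v w
    using that by (metis ext)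
  \<comment> \<open>The intersection turns the missing vertex \<open>n + 1\<close> into the zero
    vector, so the recursion along the tail needs no special case at its end.\<close>
  have in_n: "indic ({x} \<inter> {1..n}) \<in> L" if "5 \<le> x" for x
  proof -
    have "\<forall>x\<ge>5. indic ({x} \<inter> {1..n}) \<in> L"
      using n
    proof (induction rule: inc_induct)
      case base
      have "indic ({x} \<inter> {1..n}) \<in> L" if "x \<ge> n" for x
        using that assms(5) zero n by (cases "x = n") (simp_all add: indic_def)
      then show ?case
        by blast
    next
      case (step m)
      \<comment> \<open>On the tail \<open>A e\<^sub>m\<^sub>+\<^sub>1 = e\<^sub>m +
        e\<^sub>m\<^sub>+\<^sub>2\<close>, which yields the indicators one by one from
        \<open>n\<close> down to 5.\<close>
      have eq: "mat_vec n (indic {Suc m}) x - indic ({Suc (Suc m)} \<inter> {1..n}) x = indic {m} x" for x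
        using step(1,2) n
        by (subst mat_vec_indic) (auto simp: adj_matrix_Delta indic_def dadj_def)
      have mem: "indic {Suc m} \<in> L" "indic ({Suc (Suc m)} \<inter> {1..n}) \<in> L"
        using step(3)[rule_format, of "Suc m"] step(3)[rule_format, of "Suc (Suc m)"] step(2)
        by (simp_all del: atLeastAtMost_iff) (simp add: indic_def)
      have "indic {m} \<in> L"
        by (rule L_cong[OF diff[OF act[OF mem(1)] mem(2)] eq])
      then have "indic ({m} \<inter> {1..n}) \<in> L"
        using step(1,2) by simp
      then show ?case
        using step(3) by (metis Suc_leI le_neq_implies_less)
    qed
    then show ?thesis
      using that by blast
  qed
  then have e5: "indic {5} \<in> L" and e6: "indic ({6} \<inter> {1..n}) \<in> L"
    using in_n[of 5] in_n[of 6] n by simp_all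
  \<comment> \<open>The neighbours of 5 are the four path vertices and, if present, 6.\<close>
  have "mat_vec n (indic {5}) x - indic ({6} \<inter> {1..n}) x = indic {1, 2, 3, 4} x" for x
    using n by (subst mat_vec_indic) (auto simp: adj_matrix_Delta indic_def dadj_def)
  then have w: "indic {1, 2, 3, 4} \<in> L"
    by (rule L_cong[OF diff[OF act[OF e5] e6]])
  \<comment> \<open>Within the path the degrees are 1, 2, 2, 1, so subtracting the all-ones vector
    leaves the inner orbit; the 4 is the number of path vertices adjacent to 5. This separates the
    two orbits of the layer.\<close>
  have "(mat_vec n (indic {1, 2, 3, 4}) x - indic {1, 2, 3, 4} x) - 4 * indic {5} x = indic {2, 3} x" for x
  proof -
    consider "x = 1" | "x = 2" | "x = 3" | "x = 4" | "x = 5" | "x \<notin> {1, 2, 3, 4, 5}"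
      by blast
    then show ?thesis
      using n by cases (subst mat_vec_indic; simp add: adj_matrix_Delta indic_def dadj_def)+
  qed
  then have u2: "indic {2, 3} \<in> L"
    by (rule L_cong[OF diff[OF diff[OF act[OF w] w] scale[OF e5, of 4]]])
  have "indic {1, 2, 3, 4} x - indic {2, 3} x = indic {1, 4} x" for x
    by (simp add: indic_def)
  then have u1: "indic {1, 4} \<in> L"
    by (rule L_cong[OF diff[OF w u2]])
  consider "k \<notin> {1..n - 2}" | "k = Suc 0" | "k = 2" | "k \<in> {3..n - 2}"
    by fastforce
  then show ?thesis
  proof cases
    case 1
    then show ?thesis
      using zero orbit_set(4)[OF n, of k] by (simp add: indic_def)
  next
    case 4
    then have "orbit n k = {k + 2} \<inter> {1..n}"
      using orbit_set(3)[OF n, of "k + 2"] by auto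
    then show ?thesis
      using in_n[of "k + 2"] 4 by simp
  qed (use u1 u2 orbit_set[OF n] in simp_all)
qed

definition outer :: "(nat \<Rightarrow> complex) \<Rightarrow> (nat \<Rightarrow> complex) \<Rightarrow> nat cmat"
  where "outer v w = (\<lambda>x y. v x * w y)"

text \<open>\<open>E\<^sub>n\<close> is the outer square of \<open>e\<^sub>n\<close>. Multiplying by
  \<open>A\<close> on the left acts on the first factor of an outer product, and, as
  \<open>A\<close> is symmetric, multiplying on the right acts on the second. The cyclic-vector
  lemma therefore applies to each factor in turn.\<close>

lemma outer_orbits_in_subalgebra:
  assumes n: "n \<ge> 5" and B: "unital_subalgebra B (mat_alg {1..n})"
    and A: "adj_matrix (Delta_graph n) \<in> B" and E: "diag_ind {n} \<in> B"
  shows "outer (indic (orbit n i)) (indic (orbit n j)) \<in> B"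
proof -
  note B = unital_subalgebra_mat_algD[OF B]
  have A_sym: "adj_matrix (Delta_graph n) x y = adj_matrix (Delta_graph n) y x" for x y
    using dadj_sym[of n x y] by (simp add: adj_matrix_Delta[OF n])
  have add1: "outer (\<lambda>x. v x + w x) u = outer v u + outer w u"
    and add2: "outer u (\<lambda>x. v x + w x) = outer u v + outer u w"
    and scale1: "outer (\<lambda>x. c * v x) u = mat_scale c (outer v u)"
    and scale2: "outer u (\<lambda>x. c * v x) = mat_scale c (outer u v)" for u v w c
    by (simp_all add: outer_def fun_eq_iff mat_scale_def algebra_simps)
  have act1: "outer (mat_vec n v) u = adj_matrix (Delta_graph n) \<otimes>\<^bsub>mat_alg {1..n}\<^esub> outer v u" for u v
    unfolding outer_def mat_vec_def mat_alg_sel sum_distrib_right mult.assoc ..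
  have act2: "outer u (mat_vec n v) = outer u v \<otimes>\<^bsub>mat_alg {1..n}\<^esub> adj_matrix (Delta_graph n)" for u v
    unfolding outer_def mat_vec_def mat_alg_sel sum_distrib_left
    by (intro ext sum.cong refl) (simp add: A_sym[of _ "_ :: nat"] mult_ac)
  have "outer (indic {n}) (indic {n}) = diag_ind {n}"
    by (auto simp: outer_def indic_def diag_ind_def fun_eq_iff)
  then have base: "outer (indic {n}) (indic {n}) \<in> B"
    using E by simp
  have "indic (orbit n i) \<in> {v. outer v (indic {n}) \<in> B}"
    using n by (rule orbit_indicators_from_base) (auto simp only: mem_Collect_eq add1 scale1 act1 intro: B A base)
  then have base': "outer (indic (orbit n i)) (indic {n}) \<in> B"
    by simp
  have "indic (orbit n j) \<in> {w. outer (indic (orbit n i)) w \<in> B}"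
    using n by (rule orbit_indicators_from_base) (auto simp only: mem_Collect_eq add2 scale2 act2 intro: B A base')
  then show ?thesis
    by simp
qed

text \<open>Modulo the identity and \<open>A\<close>, every element has zero antisymmetric block,
  and the invariant matrices with zero antisymmetric block are spanned by the outer products of
  orbit indicators.\<close>

lemma adj_anti_subset:
  assumes n: "n \<ge> 5" and B: "unital_subalgebra B (mat_alg {1..n})"
    and A: "adj_matrix (Delta_graph n) \<in> B" and E: "diag_ind {n} \<in> B"
  shows "adj_anti n \<subseteq> B"
proof
  note BD = unital_subalgebra_mat_algD[OF B]
  note flip = unital_subalgebra_mat_algD[OF subalgebra_flip_inv[OF n]]
  have kernel: "M \<in> B" if M: "M \<in> flip_inv n" and "anti_block M = 0" for M
  proof -
    define P where "P = sym_block n M"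
    \<comment> \<open>The common value of \<open>M\<close> on the orbit pair \<open>i\<close>,
      \<open>j\<close>; the halving is the one in \<open>assemble\<close>, as orbits 1 and 2 have
      two elements.\<close>
    define f where "f i j = P i j / (if j \<le> 2 then 2 else 1)" for i j
    have "f (orb x) (orb y) = M x y" for x y
    proof -
      have "M x y = assemble P 0 x y"
        using assemble_blocks[OF n M] that(2) by (simp add: P_def)
      also have "\<dots> = f (orb x) (orb y)"
        by (auto simp: assemble_def f_def orb_def)
      finally show ?thesis ..
    qed
    moreover have "(\<Sum>i\<in>{1..n - 2}. \<Sum>j\<in>{1..n - 2}.
        mat_scale (f i j) (outer (indic (orbit n i)) (indic (orbit n j)))) x y = f (orb x) (orb y)" for x y
    proof -
      have ind: "indic (orbit n i) x = (if i = orb x then 1 else 0)"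
        if "i \<in> {1..n - 2}" for i x
        using that orb_in[OF n, of x] by (auto simp: indic_def orbit_def)
      have "(\<Sum>i\<in>{1..n - 2}. \<Sum>j\<in>{1..n - 2}.
          mat_scale (f i j) (outer (indic (orbit n i)) (indic (orbit n j)))) x y
        = (\<Sum>i\<in>{1..n - 2}. \<Sum>j\<in>{1..n - 2}. if i = orb x then if j = orb y then f i j else 0 else 0)"
        unfolding sum_mat_apply
        by (intro sum.cong refl) (simp add: ind mat_scale_def outer_def del: atLeastAtMost_iff)
      also have "\<dots> = (\<Sum>i\<in>{1..n - 2}. if i = orb x then
          if orb y \<in> {1..n - 2} then f i (orb y) else 0 else 0)"
        by (intro sum.cong refl) simp
      also have "\<dots> = (if orb x \<in> {1..n - 2} \<and> orb y \<in> {1..n - 2} then f (orb x) (orb y) else 0)"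
        by simp
      also have "\<dots> = f (orb x) (orb y)"
        using mat_alg_outside[OF sym_block_carrier[OF n M]] unfolding f_def P_def by auto
      finally show ?thesis .
    qed
    ultimately have "M = (\<Sum>i\<in>{1..n - 2}. \<Sum>j\<in>{1..n - 2}.
        mat_scale (f i j) (outer (indic (orbit n i)) (indic (orbit n j))))"
      by (simp add: fun_eq_iff)
    also have "\<dots> \<in> B"
      by (intro unital_subalgebra_sum[OF B] BD(5) outer_orbits_in_subalgebra[OF n B A E])
    finally show ?thesis .
  qed
  fix M assume M: "M \<in> adj_anti n"
  define A' where "A' = adj_matrix (Delta_graph n)"
  define a b where "a = anti_block M 1 1" and "b = anti_block M 1 2"
  \<comment> \<open>The antisymmetric block of \<open>M\<close> equals \<open>a\<close> times the
    identity plus \<open>b\<close> times that of \<open>A'\<close>, so subtracting this combination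
    kills it.\<close>
  define K where "K = M + mat_scale (- a) (diag_ind {1..n}) + mat_scale (- b) A'"
  have "anti_block K i j = 0" for i j
  proof (cases "i \<in> {1, 2} \<and> j \<in> {1, 2}")
    case True
    have "anti_block K i j = anti_block M i j - a * diag_ind {1..2} i j - b * anti_block A' i j"
      unfolding K_def by (simp add: anti_block_add anti_block_scale anti_block_one[OF n] mat_scale_apply del: One_nat_def)
    moreover have "anti_block M 2 1 = b" "anti_block M 2 2 = a - b"
      using M by (simp_all add: adj_anti_def a_def b_def)
    moreover note a_def b_def anti_block_adj_matrix[OF n]
    ultimately show ?thesis
      using True unfolding A'_def
      by (elim conjE insertE emptyE) (simp_all add: diag_ind_def del: One_nat_def)
  qed (auto simp: anti_block_def)
  then have "anti_block K = 0"
    by (simp add: fun_eq_iff)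
  moreover have "K \<in> flip_inv n"
    using M flip(2,3,5) adj_matrix_flip_inv[OF n] by (simp add: K_def A'_def adj_anti_def)
  ultimately have "K \<in> B"
    by (rule kernel[rotated])
  then have "K + mat_scale a (diag_ind {1..n}) + mat_scale b A' \<in> B"
    using BD(2,3,5) A by (simp add: A'_def)
  moreover have "K + mat_scale a (diag_ind {1..n}) + mat_scale b A' = M"
    by (simp add: K_def fun_eq_iff mat_scale_def)
  ultimately show "M \<in> B"
    by simp
qed

text \<open>The antisymmetric blocks of \<open>F\<close> and \<open>G = F A\<close> are the matrix
  units in positions (1, 1) and (1, 2). With the span of the identity and
  \<open>((0, 1), (1, -1))\<close> these fill all two-by-two matrices, so \<open>M\<close> can be
  corrected into \<open>adj_anti\<close>.\<close>

lemma flip_inv_subset: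
  assumes n: "n \<ge> 5" and B: "unital_subalgebra B (mat_alg {1..n})"
    and A: "adj_matrix (Delta_graph n) \<in> B" and E: "diag_ind {n} \<in> B" "diag_ind {1, 4} \<in> B"
  shows "flip_inv n \<subseteq> B"
proof
  note BD = unital_subalgebra_mat_algD[OF B]
  note flip = unital_subalgebra_mat_algD[OF subalgebra_flip_inv[OF n]]
  fix M assume M: "M \<in> flip_inv n"
  define F where "F = diag_ind {1, 4::nat}"
  define G where "G = F \<otimes>\<^bsub>mat_alg {1..n}\<^esub> adj_matrix (Delta_graph n)"
  have F: "F \<in> flip_inv n"
    unfolding F_def using n by (intro diag_ind_flip_inv) (auto simp: flip_def)
  then have G: "G \<in> flip_inv n"
    unfolding G_def by (intro flip(4) adj_matrix_flip_inv[OF n])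
  have anti_F: "anti_block F 1 1 = 1" "anti_block F 1 2 = 0" "anti_block F 2 1 = 0" "anti_block F 2 2 = 0"
    by (simp_all add: F_def anti_block_diag_ind)
  have anti_G: "anti_block G 1 1 = 0" "anti_block G 1 2 = 1" "anti_block G 2 1 = 0" "anti_block G 2 2 = 0"
    unfolding G_def anti_block_mult_apply[OF n F adj_matrix_flip_inv[OF n]]
    using anti_block_adj_matrix[OF n] anti_F by (simp_all del: One_nat_def)
  \<comment> \<open>The unique solution of the two linear equations that put \<open>K\<close> into
    \<open>adj_anti\<close>.\<close>
  define a b where "a = anti_block M 1 1 - anti_block M 2 1 - anti_block M 2 2"
    and "b = anti_block M 1 2 - anti_block M 2 1"
  define K where "K = M + mat_scale (- a) F + mat_scale (- b) G"
  have "anti_block K i j = anti_block M i j - a * anti_block F i j - b * anti_block G i j" for i j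
    unfolding K_def by (simp add: anti_block_add anti_block_scale mat_scale_apply)
  then have "K \<in> adj_anti n"
    using M F G flip(3,5) by (simp add: adj_anti_def K_def anti_F anti_G a_def b_def del: One_nat_def)
  then have "K \<in> B"
    using adj_anti_subset[OF n B A E(1)] by blast
  moreover have "F \<in> B" "G \<in> B"
    using E(2) A BD(4) by (simp_all add: F_def G_def)
  ultimately have "K + mat_scale a F + mat_scale b G \<in> B"
    using BD(3,5) by simp
  moreover have "K + mat_scale a F + mat_scale b G = M"
    by (simp add: K_def fun_eq_iff mat_scale_def)
  ultimately show "M \<in> B"
    by simp
qed

text \<open>Layer 0 is \<open>{n}\<close>, so \<open>T1\<close> lies in \<open>T2\<close>; this
  closes the chain
  \<open>adj_anti \<subseteq> T1 \<subseteq> T2 \<subseteq> adj_anti\<close>.\<close>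

lemma T12_Delta:
  assumes "n \<ge> 5"
  shows "T1 (Delta_graph n) n = adj_anti n" "T2 (Delta_graph n) n = adj_anti n"
proof -
  have "x \<in> dist_layer (Delta_graph n) n 0 \<longleftrightarrow> x = n" for x
    using graph_dist_Delta[OF assms, of x] assms by (auto simp: dist_layer_def vertices_Delta split: if_splits)
  then have "dist_layer (Delta_graph n) n 0 = {n}"
    by blast
  then have "diag_ind {n} \<in> {diag_ind (dist_layer (Delta_graph n) n k) | k. k \<le> eccentricity (Delta_graph n) n}"
    by (metis (mono_tags, lifting) mem_Collect_eq zero_le)
  then have "T1 (Delta_graph n) n \<subseteq> T2 (Delta_graph n) n"
    unfolding T1_def T2_def gen_subalgebra_def by (intro hull_mono) auto
  moreover have "adj_anti n \<subseteq> T1 (Delta_graph n) n"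
    unfolding T1_def vertices_Delta using adj_anti_subset[OF assms]
    by (intro subset_gen_subalgebraI) simp
  ultimately show "T1 (Delta_graph n) n = adj_anti n" "T2 (Delta_graph n) n = adj_anti n"
    using T2_subset_adj_anti[OF assms] by auto
qed

lemma T3_Delta:
  assumes "n \<ge> 5"
  shows "T3 (Delta_graph n) n = flip_inv n"
proof
  have "{x, flip x} \<in> stab_orbits (Delta_graph n) n" if "x \<in> {1..n}" for x
    using that by (simp add: stab_orbits_Delta[OF assms])
  from this[of n] this[of 1] have "{n} \<in> stab_orbits (Delta_graph n) n" "{1, 4} \<in> stab_orbits (Delta_graph n) n"
    using assms by (simp_all add: flip_simps)
  then have "diag_ind {n} \<in> {diag_ind Y | Y. Y \<in> stab_orbits (Delta_graph n) n}"
    "diag_ind {1, 4} \<in> {diag_ind Y | Y. Y \<in> stab_orbits (Delta_graph n) n}"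
    by blast+
  then show "flip_inv n \<subseteq> T3 (Delta_graph n) n"
    unfolding T3_def vertices_Delta using flip_inv_subset[OF assms]
    by (intro subset_gen_subalgebraI) blast
qed (rule T3_subset_flip_inv[OF assms])


section \<open>Isomorphism types and dimensions\<close>

lemma sym_block_one:
  assumes "n \<ge> 5"
  shows "sym_block n (diag_ind {1..n}) = diag_ind {1..n - 2}"
proof (intro ext)
  fix i j
  have "sym_block n (diag_ind {1..n}) i j = (\<Sum>y\<in>orbit n j. if rep i = y then 1 else 0)"
    unfolding sym_block_def by (intro sum.cong) (auto simp: diag_ind_def orbit_def)
  also have "\<dots> = (if rep i \<in> orbit n j then 1 else 0)"
    by (simp add: orbit_def)
  also have "\<dots> = diag_ind {1..n - 2} i j"
    using rep_in[OF assms, of i] orb_rep[of i] unfolding orbit_def diag_ind_def by auto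
  finally show "sym_block n (diag_ind {1..n}) i j = diag_ind {1..n - 2} i j" .
qed

lemma flip_inv_iso:
  assumes "n \<ge> 5"
  shows "as_alg {1..n} (flip_inv n) \<cong>\<^sub>a mat_alg {1..n - 2} \<oplus>\<^sub>a mat_alg {1..2::nat}"
  unfolding alg_iso_def
proof (intro bexI allI ballI)
  let ?h = "\<lambda>M. (sym_block n M, anti_block M)"
  let ?R = "as_alg {1..n} (flip_inv n)" and ?S = "mat_alg {1..n - 2} \<oplus>\<^sub>a mat_alg {1..2::nat}"
  have "?h \<in> ring_hom ?R ?S"
    using sym_block_carrier[OF assms] anti_block_carrier sym_block_mult[OF assms] anti_block_mult[OF assms]
    by (intro ring_hom_memI) (simp_all add: as_alg_sel alg_dirsum_sel mat_alg_sel(3,5)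
      sym_block_add anti_block_add sym_block_one[OF assms] anti_block_one[OF assms] del: One_nat_def)
  moreover have "bij_betw ?h (carrier ?R) (carrier ?S)"
    using sym_block_carrier[OF assms] anti_block_carrier assemble_in[OF assms]
      assemble_blocks[OF assms] blocks_assemble[OF assms]
    by (intro bij_betw_byWitness[where f' = "\<lambda>(P, Q). assemble P Q"])
      (auto simp: as_alg_sel alg_dirsum_sel simp del: One_nat_def)
  ultimately show "?h \<in> ring_iso ?R ?S"
    by (simp add: ring_iso_def)
  show "?h (c \<odot>\<^bsub>?R\<^esub> M) = c \<odot>\<^bsub>?S\<^esub> ?h M" for c M
    by (simp add: as_alg_sel alg_dirsum_sel mat_alg_sel(6) sym_block_scale anti_block_scale)
qed

text \<open>The combination \<open>a + b T\<close> with \<open>T = ((0, 1), (1, -1))\<close>, the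
  general antisymmetric block in \<open>adj_anti\<close>.\<close>

definition anti_mat :: "complex \<Rightarrow> complex \<Rightarrow> nat cmat"
  where "anti_mat a b = (\<lambda>i j. if i = 1 \<and> j = 1 then a
    else if i = 1 \<and> j = 2 \<or> i = 2 \<and> j = 1 then b else if i = 2 \<and> j = 2 then a - b else 0)"

lemma anti_mat_carrier: "anti_mat a b \<in> carrier (mat_alg {1..2})"
  by (auto simp: anti_mat_def mat_alg_sel)

lemma anti_block_adj_anti:
  assumes "M \<in> adj_anti n"
  shows "anti_block M = anti_mat (anti_block M 1 1) (anti_block M 1 2)"
proof (intro ext)
  fix i j
  have M: "anti_block M 2 1 = anti_block M 1 2" "anti_block M 2 2 = anti_block M 1 1 - anti_block M 1 2"
    using assms by (simp_all add: adj_anti_def)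
  show "anti_block M i j = anti_mat (anti_block M 1 1) (anti_block M 1 2) i j"
  proof (cases "i \<in> {1..2} \<and> j \<in> {1..2}")
    case True
    then have "i \<in> {1, 2} \<and> j \<in> {1, 2}"
      by auto
    then show ?thesis
      by (elim conjE insertE emptyE) (simp_all add: anti_mat_def M del: One_nat_def)
  next
    case False
    then show ?thesis
      using mat_alg_outside[OF anti_block_carrier, of i j M] mat_alg_outside[OF anti_mat_carrier, of i j]
      by metis
  qed
qed

lemma assemble_adj_anti:
  assumes "n \<ge> 5" "P \<in> carrier (mat_alg {1..n - 2})"
  shows "assemble P (anti_mat a b) \<in> adj_anti n"
  using assemble_in[OF assms anti_mat_carrier] blocks_assemble(2)[OF assms anti_mat_carrier]
  by (simp add: adj_anti_def) (simp add: anti_mat_def)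

text \<open>The summands \<open>\<complex>\<close> belong to the two eigenvalues of \<open>((0, 1), (1, -1))\<close>, the roots of
  \<open>r\<^sup>2 = 1 - r\<close>.\<close>

lemma adj_anti_iso:
  assumes n: "n \<ge> 5"
  shows "as_alg {1..n} (adj_anti n) \<cong>\<^sub>a mat_alg {1..n - 2} \<oplus>\<^sub>a complex_alg \<oplus>\<^sub>a complex_alg"
  unfolding alg_iso_def
proof (intro bexI allI ballI)
  define r s where "r = complex_of_real ((sqrt 5 - 1) / 2)" and "s = complex_of_real ((- sqrt 5 - 1) / 2)"
  have root: "complex_of_real x * complex_of_real x = 1 - complex_of_real x" if "x * x = 1 - x" for x
    using arg_cong[OF that, of complex_of_real] by simp
  have r2: "r * r = 1 - r" and s2: "s * s = 1 - s"
    unfolding r_def s_def by (rule root; simp add: field_simps)+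
  have "(sqrt 5 - 1) / 2 \<noteq> (- sqrt 5 - 1) / 2"
    by simp
  then have rs: "r - s \<noteq> 0"
    unfolding r_def s_def right_minus_eq of_real_eq_iff .
  \<comment> \<open>The block \<open>a + b T\<close> is evaluated at \<open>T = t\<close>. This is
    multiplicative when \<open>t\<^sup>2 = 1 - t\<close>, the relation that \<open>T\<close>
    satisfies.\<close>
  define ev where "ev t M = anti_block M 1 1 + t * anti_block M 1 2" for t and M :: "nat cmat"
  let ?h = "\<lambda>M. (sym_block n M, ev r M, ev s M)"
  \<comment> \<open>The arguments of \<open>anti_mat\<close> solve \<open>a + r b = u\<close> and
    \<open>a + s b = v\<close>.\<close>
  let ?g = "\<lambda>(P, u, v). assemble P (anti_mat (u - r * ((u - v) / (r - s))) ((u - v) / (r - s)))"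
  let ?R = "as_alg {1..n} (adj_anti n)" and ?S = "mat_alg {1..n - 2} \<oplus>\<^sub>a complex_alg \<oplus>\<^sub>a complex_alg"
  have inv: "M \<in> flip_inv n" if "M \<in> adj_anti n" for M
    using that by (simp add: adj_anti_def)
  have ev_mult: "ev t (M \<otimes>\<^bsub>mat_alg {1..n}\<^esub> N) = ev t M * ev t N"
    if M: "M \<in> adj_anti n" and N: "N \<in> adj_anti n" and t: "t * t = 1 - t" for t M N
  proof -
    define a b c d where "a = anti_block M 1 1" and "b = anti_block M 1 2"
      and "c = anti_block N 1 1" and "d = anti_block N 1 2"
    have "anti_block N 2 1 = d" "anti_block N 2 2 = c - d"
      using N by (simp_all add: adj_anti_def c_def d_def)
    then have "ev t (M \<otimes>\<^bsub>mat_alg {1..n}\<^esub> N) = a * c + b * d + t * (a * d + b * (c - d))"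
      unfolding ev_def anti_block_mult_apply[OF n inv[OF M] inv[OF N]] a_def b_def c_def d_def by simp
    also have "\<dots> = a * c + t * (a * d + b * c) + (1 - t) * (b * d)"
      by (simp add: algebra_simps)
    also have "\<dots> = (a + t * b) * (c + t * d)"
      unfolding t[symmetric] by (simp add: algebra_simps)
    finally show ?thesis
      by (simp add: ev_def a_def b_def c_def d_def)
  qed
  have ev_add: "ev t (M + N) = ev t M + ev t N" and ev_scale: "ev t (mat_scale c M) = c * ev t M" for t c M N
    by (simp_all add: ev_def anti_block_add anti_block_scale mat_scale_apply algebra_simps)
  have ev_one: "ev t (diag_ind {1..n}) = 1" for t
    using n by (simp add: ev_def anti_block_diag_ind)
  have "?h \<in> ring_hom ?R ?S"
    using sym_block_carrier[OF n] sym_block_mult[OF n] inv ev_mult r2 s2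
    by (intro ring_hom_memI) (simp_all add: as_alg_sel alg_dirsum_sel mat_alg_sel(3,5) complex_alg_sel
      sym_block_add ev_add sym_block_one[OF n] ev_one del: One_nat_def)
  moreover have "bij_betw ?h (carrier ?R) (carrier ?S)"
  proof (rule bij_betw_byWitness[where f' = ?g])
    show "\<forall>M\<in>carrier ?R. ?g (?h M) = M"
    proof
      fix M assume "M \<in> carrier ?R"
      then have M: "M \<in> adj_anti n"
        by (simp add: as_alg_sel)
      have "ev r M - ev s M = (r - s) * anti_block M 1 2"
        by (simp add: ev_def algebra_simps)
      then have q: "(ev r M - ev s M) / (r - s) = anti_block M 1 2"
        using rs by simp
      have d: "ev r M - r * anti_block M 1 2 = anti_block M 1 1"
        by (simp add: ev_def)
      then show "?g (?h M) = M"
        by (simp only: case_prod_conv q d anti_block_adj_anti[OF M, symmetric]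
            assemble_blocks[OF n inv[OF M]])
    qed
    show "\<forall>x\<in>carrier ?S. ?h (?g x) = x"
    proof
      fix x assume "x \<in> carrier ?S"
      then obtain P u v where x: "x = (P, u, v)" and P: "P \<in> carrier (mat_alg {1..n - 2})"
        by (auto simp: alg_dirsum_sel)
      define q where "q = (u - v) / (r - s)"
      have "q * (r - s) = u - v"
        using rs by (simp add: q_def)
      then have "u - r * q + s * q = v"
        by (simp add: algebra_simps)
      then show "?h (?g x) = x"
        unfolding x case_prod_conv q_def[symmetric] ev_def blocks_assemble[OF n P anti_mat_carrier]
        by (simp add: anti_mat_def)
    qed
    show "?h ` carrier ?R \<subseteq> carrier ?S"
      using sym_block_carrier[OF n] inv by (auto simp: as_alg_sel alg_dirsum_sel complex_alg_sel)
    show "?g ` carrier ?S \<subseteq> carrier ?R"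
      using assemble_adj_anti[OF n] by (auto simp: as_alg_sel alg_dirsum_sel)
  qed
  ultimately show "?h \<in> ring_iso ?R ?S"
    by (simp add: ring_iso_def)
  show "?h (c \<odot>\<^bsub>?R\<^esub> M) = c \<odot>\<^bsub>?S\<^esub> ?h M" for c M
    by (simp add: as_alg_sel alg_dirsum_sel mat_alg_sel(6) complex_alg_sel sym_block_scale ev_scale)
qed

section \<open>Dimensions by counting block entries\<close>

lemma subspace_unital_subalgebra:
  assumes "unital_subalgebra B (mat_alg X)"
  shows "module.subspace mat_scale B"
proof -
  interpret vector_space "mat_scale :: complex \<Rightarrow> 'a cmat \<Rightarrow> 'a cmat"
    by (rule vector_space_mat_scale)
  show ?thesis
    using unital_subalgebra_sum[OF assms, of "{}"] unital_subalgebra_mat_algD[OF assms]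
    by (intro subspaceI) auto
qed

text \<open>The set \<open>J\<close> selects entries of the antisymmetric block that are free coordinates on \<open>S\<close>.\<close>

lemma mat_dim_blocks:
  fixes J :: "(nat \<times> nat) set"
  assumes n: "n \<ge> 5" and S: "unital_subalgebra S (mat_alg {1..n})" "S \<subseteq> flip_inv n"
    and J: "finite J"
    and q: "\<And>p. p \<in> J \<Longrightarrow> q p \<in> carrier (mat_alg {1..2})"
    and sym_in: "\<And>P. P \<in> carrier (mat_alg {1..n - 2}) \<Longrightarrow> assemble P 0 \<in> S"
    and anti_in: "\<And>p. p \<in> J \<Longrightarrow> assemble 0 (q p) \<in> S"
    and dual: "\<And>p i j. p \<in> J \<Longrightarrow> (i, j) \<in> J \<Longrightarrow> q p i j = (if (i, j) = p then 1 else 0)"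
    and ker: "\<And>M. M \<in> S \<Longrightarrow> (\<And>i j. (i, j) \<in> J \<Longrightarrow> anti_block M i j = 0) \<Longrightarrow> anti_block M = 0"
  shows "mat_dim S = (n - 2)^2 + card J"
proof -
  define unit :: "nat \<times> nat \<Rightarrow> nat cmat" where "unit p = (\<lambda>x y. if (x, y) = p then 1 else 0)" for p
  let ?K = "{1..n - 2} \<times> {1..n - 2}"
  \<comment> \<open>The left summand indexes matrix units of the symmetric block, the right one the
    free antisymmetric coordinates. The dual functionals read off the corresponding block
    entries.\<close>
  let ?b = "case_sum (\<lambda>p. assemble (unit p) 0) (\<lambda>p. assemble 0 (q p))"
  let ?\<phi> = "case_sum (\<lambda>(i, j) M. sym_block n M i j) (\<lambda>(i, j) M. anti_block M i j)"
  have zero: "(0 :: nat cmat) \<in> carrier (mat_alg X)" for X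
    by (simp add: mat_alg_sel)
  have unit_apply: "unit p x y = (if (x, y) = p then 1 else 0)" for p x y
    by (simp add: unit_def)
  have unit: "unit p \<in> carrier (mat_alg {1..n - 2})" if "p \<in> ?K" for p
    using that by (auto simp: unit_def mat_alg_sel)
  have blocks_b: "sym_block n (assemble (unit p) 0) = unit p" "anti_block (assemble (unit p) 0) = 0"
    if "p \<in> ?K" for p
    using blocks_assemble[OF n unit[OF that] zero] by simp_all
  have blocks_q: "sym_block n (assemble 0 (q p)) = 0" "anti_block (assemble 0 (q p)) = q p"
    if "p \<in> J" for p
    using blocks_assemble[OF n zero q[OF that]] by simp_all
  have "mat_dim S = card (?K <+> J)"
  proof (rule mat_dim_eq_card[where b = ?b and \<phi> = ?\<phi>])
    show "module.subspace mat_scale S"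
      by (rule subspace_unital_subalgebra[OF S(1)])
    show "?b i \<in> S" if "i \<in> ?K <+> J" for i
      using that sym_in[OF unit] anti_in by auto
    show "?\<phi> i (M + N) = ?\<phi> i M + ?\<phi> i N" for i M N
      by (auto simp: sym_block_add anti_block_add split: sum.split)
    show "?\<phi> i (mat_scale c M) = c * ?\<phi> i M" for i c M
      by (auto simp: sym_block_scale anti_block_scale mat_scale_apply split: sum.split)
    show "?\<phi> i (?b j) = (if i = j then 1 else 0)" if "i \<in> ?K <+> J" "j \<in> ?K <+> J" for i j
      using that
      by (elim PlusE) (auto simp: blocks_b blocks_q dual unit_apply split: if_splits simp del: atLeastAtMost_iff)
    show "M = 0" if M: "M \<in> S" and vanish: "\<And>i. i \<in> ?K <+> J \<Longrightarrow> ?\<phi> i M = 0" for M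
    proof -
      have inv: "M \<in> flip_inv n"
        using M S(2) by blast
      have "sym_block n M i j = 0" for i j
      proof (cases "(i, j) \<in> ?K")
        case True
        then show ?thesis
          using vanish[OF InlI] by fastforce
      next
        case False
        then show ?thesis
          using mat_alg_outside[OF sym_block_carrier[OF n inv]] by blast
      qed
      then have "sym_block n M = 0"
        by (simp add: fun_eq_iff)
      moreover have "anti_block M = 0"
        using vanish[OF InrI] by (intro ker[OF M]) fastforce
      ultimately show ?thesis
        using assemble_blocks[OF n inv] by (simp add: assemble_def fun_eq_iff)
    qed
  qed (use J in simp)
  then show ?thesis
    using J by (simp add: card_Plus power2_eq_square)
qed

lemma mat_dim_adj_anti:
  assumes "n \<ge> 5"
  shows "mat_dim (adj_anti n) = (n - 2)^2 + 2"
proof -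
  have anti_zero: "anti_mat 0 0 = 0"
    by (simp add: anti_mat_def fun_eq_iff)
  \<comment> \<open>The first row is a free coordinate system on the blocks \<open>a + b T\<close>;
    the identity and \<open>T\<close> form the dual basis.\<close>
  let ?q = "\<lambda>p. if p = (1, 1) then anti_mat 1 0 else anti_mat 0 1"
  have "mat_dim (adj_anti n) = (n - 2)^2 + card {(1, 1), (1 :: nat, 2 :: nat)}"
  proof (rule mat_dim_blocks[OF assms subalgebra_adj_anti[OF assms], where q = ?q])
    show "assemble P 0 \<in> adj_anti n" if "P \<in> carrier (mat_alg {1..n - 2})" for P
      using assemble_adj_anti[OF assms that, of 0 0] by (simp add: anti_zero)
    show "assemble 0 (?q p) \<in> adj_anti n" for p
      using assemble_adj_anti[OF assms, of 0] by (simp add: mat_alg_sel)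
    show "?q p i j = (if (i, j) = p then 1 else 0)"
      if "p \<in> {(1, 1), (1, 2)}" "(i, j) \<in> {(1, 1), (1, 2)}" for p i j
      using that by (auto simp: anti_mat_def)
    show "anti_block M = 0"
      if "M \<in> adj_anti n" "\<And>i j. (i, j) \<in> {(1, 1), (1, 2)} \<Longrightarrow> anti_block M i j = 0" for M
      using anti_block_adj_anti[OF that(1)] that(2)[of 1 1] that(2)[of 1 2] by (simp add: anti_zero)
    show "?q p \<in> carrier (mat_alg {1..2})" for p
      using anti_mat_carrier by simp
  qed (auto simp: adj_anti_def)
  then show ?thesis
    by simp
qed

lemma mat_dim_flip_inv:
  assumes "n \<ge> 5"
  shows "mat_dim (flip_inv n) = (n - 2)^2 + 4"
proof -
  have "anti_block M = 0" if "\<And>i j. (i, j) \<in> {1..2} \<times> {1..2} \<Longrightarrow> anti_block M i j = 0" for M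
    using that by (auto simp: fun_eq_iff anti_block_def)
  then have "mat_dim (flip_inv n) = (n - 2)^2 + card ({1..2::nat} \<times> {1..2::nat})"
    by (intro mat_dim_blocks[OF assms subalgebra_flip_inv[OF assms],
          where q = "\<lambda>p x y. if (x, y) = p then 1 else 0"]
        assemble_in[OF assms]) (auto simp: mat_alg_sel)
  then show ?thesis
    by simp
qed

theorem theorem9p3:
  fixes n :: nat
  assumes "n \<ge> 5"
  shows
    "(T1 (Delta_graph n) n = T2 (Delta_graph n) n \<and>
      as_alg (vertices (Delta_graph n)) (T2 (Delta_graph n) n)
        \<cong>\<^sub>a mat_alg {1..n - 2} \<oplus>\<^sub>a complex_alg \<oplus>\<^sub>a complex_alg) \<and>
     (T3 (Delta_graph n) n = T4 (Delta_graph n) n \<and>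
      as_alg (vertices (Delta_graph n)) (T4 (Delta_graph n) n)
        \<cong>\<^sub>a mat_alg {1..n - 2} \<oplus>\<^sub>a mat_alg {1..2::nat}) \<and>
     (int (mat_dim (T1 (Delta_graph n) n)) = int (mat_dim (T2 (Delta_graph n) n)) \<and>
      int (mat_dim (T2 (Delta_graph n) n)) = (int n)^2 - 4 * int n + 6 \<and>
      (int n)^2 - 4 * int n + 6 < (int n)^2 - 4 * int n + 8 \<and>
      (int n)^2 - 4 * int n + 8 = int (mat_dim (T3 (Delta_graph n) n)) \<and>
      int (mat_dim (T3 (Delta_graph n) n)) = int (mat_dim (T4 (Delta_graph n) n)))"
proof -
  \<comment> \<open>The dimensions are \<open>(n - 2)^2 + 2\<close> and
    \<open>(n - 2)^2 + 4\<close>; the bound on \<open>n\<close> makes the truncated subtraction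
    exact.\<close>
  have "int ((n - 2)^2) = (int n - 2)^2"
    using assms by (simp add: of_nat_diff)
  then have "int ((n - 2)^2) = (int n)^2 - 4 * int n + 4"
    by (simp add: power2_eq_square algebra_simps)
  then show ?thesis
    unfolding T12_Delta[OF assms] T3_Delta[OF assms] T4_Delta[OF assms] vertices_Delta
      mat_dim_adj_anti[OF assms] mat_dim_flip_inv[OF assms]
    using adj_anti_iso[OF assms] flip_inv_iso[OF assms] by simp
qed

end
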